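(* Let $X$ be a Tychonov space, and let every topological group below be equipped with its right uniformity. Then the following conditions are equivalent: (1) $F(X)$ has the property $\bigcup_{fin}(\mathcal O,\Gamma)$ (as a uniform space); (2) $F(X)^n$ has the property $\bigcup_{fin}(\mathcal O,\Gamma)$ (as a uniform space) for all $n\in\mathbb N$; (3) $A(X)$ has the property $\bigcup_{fin}(\mathcal O,\Gamma)$ (as a uniform space); (4) $A(X)^n$ has the property $\bigcup_{fin}(\mathcal O,\Gamma)$ (as a uniform space) for all $n\in\mathbb N$; (5) the uniform space $(X,\mathcal U(X))$ has the property $\bigcup_{fin}(\mathcal O,\Gamma)$.
   Context: $F(X)$ and $A(X)$ denote the free topological group and the free abelian topological group (in the sense of Markov) over the Tychonov space $X$: $X$ is a topological subspace of $F(X)$ (resp. $A(X)$) which generates it algebraically, and every continuous map from $X$ to a topological group (resp. abelian topological group) extends to a continuous homomorphism on $F(X)$ (resp. $A(X)$). Powers $G^n$ carry the product group structure and topology. The right uniformity of a topological group $G$ is the one generated by the entourages $\{(x,y)\in G\times G: xy^{-1}\in U\}$, where $U$ runs over the neighbourhoods of the identity. $\mathcal U(X)$ is the universal uniformity of $X$: the uniformity that generates the topology of $X$ and contains all uniformities on $X$ with this property. A cover $u$ of a uniform space $(Z,\mathcal U)$ is uniform if there is an entourage $E\in\mathcal U$ such that for each $z\in Z$ the set $E[z]=\{y:(z,y)\in E\}$ is contained in some member of $u$; it is an open uniform cover if moreover its members are open in the topology generated by $\mathcal U$. The uniform space $(Z,\mathcal U)$ has the property $\bigcup_{fin}(\mathcal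 O,\Gamma)$ if for every sequence $(u_n)_{n\in\omega}$ of open uniform covers of $Z$ there is a sequence $(v_n)_{n\in\omega}$, each $v_n$ a finite subfamily of $u_n$, such that $\{\bigcup v_n:n\in\omega\}$ is a $\gamma$-cover of $Z$, i.e. every $z\in Z$ belongs to $\bigcup v_n$ for all but finitely many $n\in\omega$. *)

theory Defs
  imports "HOL-Analysis.Analysis" "HOL-Algebra.Product_Groups"
begin

section \<open>Uniform spaces with an explicit carrier\<close>

text \<open>The library's class of uniform spaces fixes one uniformity per type. Here a uniformity
  is the set of its entourages on a carrier set \<open>Z\<close>.\<close>

definition is_uniformity :: "'a set \<Rightarrow> ('a \<times> 'a) set set \<Rightarrow> bool" where
  "is_uniformity Z \<U> \<longleftrightarrow>
     Z \<times> Z \<in> \<U> \<and>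
     (\<forall>E\<in>\<U>. E \<subseteq> Z \<times> Z \<and> Id_on Z \<subseteq> E) \<and>
     (\<forall>E\<in>\<U>. \<forall>D. E \<subseteq> D \<and> D \<subseteq> Z \<times> Z \<longrightarrow> D \<in> \<U>) \<and>
     (\<forall>E\<in>\<U>. \<forall>D\<in>\<U>. E \<inter> D \<in> \<U>) \<and>
     (\<forall>E\<in>\<U>. E\<inverse> \<in> \<U>) \<and>
     (\<forall>E\<in>\<U>. \<exists>D\<in>\<U>. D O D \<subseteq> E)"

definition uniform_topology :: "'a set \<Rightarrow> ('a \<times> 'a) set set \<Rightarrow> 'a topology" where
  "uniform_topology Z \<U> = topology (\<lambda>V. V \<subseteq> Z \<and> (\<forall>z\<in>V. \<exists>E\<in>\<U>. E `` {z} \<subseteq> V))"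

definition compatible_uniformity :: "'a topology \<Rightarrow> ('a \<times> 'a) set set \<Rightarrow> bool" where
  "compatible_uniformity X \<U> \<longleftrightarrow>
     is_uniformity (topspace X) \<U> \<and> uniform_topology (topspace X) \<U> = X"

text \<open>The description below denotes whenever \<open>X\<close> is completely regular; see
  \<open>universal_uniformity_exists\<close>.\<close>

definition universal_uniformity :: "'a topology \<Rightarrow> ('a \<times> 'a) set set" where
  "universal_uniformity X =
     (THE \<U>. compatible_uniformity X \<U> \<and> (\<forall>\<V>. compatible_uniformity X \<V> \<longrightarrow> \<V> \<subseteq> \<U>))"

definition open_uniform_cover :: "'a set \<Rightarrow> ('a \<times> 'a) set set \<Rightarrow> 'a set set \<Rightarrow> bool" where
  "open_uniform_cover Z \<U> u \<longleftrightarrow>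
     \<Union>u = Z \<and>
     (\<exists>E\<in>\<U>. \<forall>z\<in>Z. \<exists>A\<in>u. E `` {z} \<subseteq> A) \<and>
     (\<forall>A\<in>u. openin (uniform_topology Z \<U>) A)"

text \<open>The property \<open>\<Union>\<^sub>f\<^sub>i\<^sub>n(\<O>,\<Gamma>)\<close> of a uniform space.\<close>

definition Ufin_O_Gamma :: "'a set \<Rightarrow> ('a \<times> 'a) set set \<Rightarrow> bool" where
  "Ufin_O_Gamma Z \<U> \<longleftrightarrow>
     (\<forall>u :: nat \<Rightarrow> 'a set set. (\<forall>n. open_uniform_cover Z \<U> (u n)) \<longrightarrow>
        (\<exists>v :: nat \<Rightarrow> 'a set set.
           (\<forall>n. finite (v n) \<and> v n \<subseteq> u n) \<and>
           (\<forall>z\<in>Z. finite {n. z \<notin> \<Union>(v n)})))"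


section \<open>Topological groups\<close>

definition topological_group :: "('a, 'm) monoid_scheme \<Rightarrow> 'a topology \<Rightarrow> bool" where
  "topological_group G T \<longleftrightarrow>
     group G \<and> topspace T = carrier G \<and>
     continuous_map (prod_topology T T) T (\<lambda>(x, y). x \<otimes>\<^bsub>G\<^esub> y) \<and>
     continuous_map T T (\<lambda>x. inv\<^bsub>G\<^esub> x)"

definition right_uniformity :: "('a, 'm) monoid_scheme \<Rightarrow> 'a topology \<Rightarrow> ('a \<times> 'a) set set" where
  "right_uniformity G T =
     {E. E \<subseteq> carrier G \<times> carrier G \<and>
         (\<exists>U. openin T U \<and> \<one>\<^bsub>G\<^esub> \<in> U \<and>
              {(x, y) \<in> carrier G \<times> carrier G. x \<otimes>\<^bsub>G\<^esub> inv\<^bsub>G\<^esub> y \<in> U} \<subseteq> E)}"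

abbreviation group_Ufin_O_Gamma :: "('a, 'm) monoid_scheme \<Rightarrow> 'a topology \<Rightarrow> bool" where
  "group_Ufin_O_Gamma G T \<equiv> Ufin_O_Gamma (carrier G) (right_uniformity G T)"

text \<open>The power \<open>G\<^sup>n\<close> has the set of functions on \<open>{..<n}\<close> as carrier.\<close>

abbreviation power_group :: "('a, 'm) monoid_scheme \<Rightarrow> nat \<Rightarrow> (nat \<Rightarrow> 'a) monoid" where
  "power_group G n \<equiv> product_group {..<n} (\<lambda>_. G)"

abbreviation power_topology :: "'a topology \<Rightarrow> nat \<Rightarrow> (nat \<Rightarrow> 'a) topology" where
  "power_topology T n \<equiv> product_topology (\<lambda>_. T) {..<n}"


section \<open>Free topological groups\<close>

text \<open>\<open>(G, T)\<close> together with \<open>\<eta>\<close> is a free (abelian) topological group in the sense of Markov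
  over \<open>X\<close>; the embedding \<open>\<eta>\<close> identifies \<open>X\<close> with a subspace of \<open>G\<close>. A definition cannot
  quantify over types, so the test groups \<open>H\<close> live on one fixed type, namely that of sets of
  words in the letters \<open>x\<close> and \<open>x\<^sup>-\<^sup>1\<close> for \<open>x :: 'a\<close>. Every group generated by an image of \<open>X\<close>
  is isomorphic to one on that type, so this loses nothing: by \<open>free_topological_group_extend\<close>
  and \<open>free_abelian_topological_group_extend\<close> the universal property holds for topological
  groups on arbitrary types.\<close>

definition free_topological_group ::
  "'a topology \<Rightarrow> ('g, 'm) monoid_scheme \<Rightarrow> 'g topology \<Rightarrow> ('a \<Rightarrow> 'g) \<Rightarrow> bool" where
  "free_topological_group X G T \<eta> \<longleftrightarrow>
     topological_group G T \<and>
     embedding_map X T \<eta> \<and>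
     generate G (\<eta> ` topspace X) = carrier G \<and>
     (\<forall>(H :: (bool \<times> 'a) list set monoid) S f.
        topological_group H S \<and> continuous_map X S f \<longrightarrow>
        (\<exists>h \<in> hom G H. continuous_map T S h \<and> (\<forall>x\<in>topspace X. h (\<eta> x) = f x)))"

definition free_abelian_topological_group ::
  "'a topology \<Rightarrow> ('g, 'm) monoid_scheme \<Rightarrow> 'g topology \<Rightarrow> ('a \<Rightarrow> 'g) \<Rightarrow> bool" where
  "free_abelian_topological_group X G T \<eta> \<longleftrightarrow>
     topological_group G T \<and> comm_group G \<and>
     embedding_map X T \<eta> \<and>
     generate G (\<eta> ` topspace X) = carrier G \<and>
     (\<forall>(H :: (bool \<times> 'a) list set monoid) S f.
        topological_group H S \<and> comm_group H \<and> continuous_map X S f \<longrightarrow>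
        (\<exists>h \<in> hom G H. continuous_map T S h \<and> (\<forall>x\<in>topspace X. h (\<eta> x) = f x)))"


section \<open>Basic facts showing that the definitions are meaningful\<close>

subsection \<open>Uniformities\<close>

lemma
  assumes "is_uniformity Z \<U>"
  shows is_uniformity_carrier: "Z \<times> Z \<in> \<U>"
    and is_uniformity_subset: "E \<in> \<U> \<Longrightarrow> E \<subseteq> Z \<times> Z"
    and is_uniformity_refl: "E \<in> \<U> \<Longrightarrow> Id_on Z \<subseteq> E"
    and is_uniformity_Int: "E \<in> \<U> \<Longrightarrow> D \<in> \<U> \<Longrightarrow> E \<inter> D \<in> \<U>"
    and is_uniformity_converse: "E \<in> \<U> \<Longrightarrow> E\<inverse> \<in> \<U>"
    and is_uniformity_half: "E \<in> \<U> \<Longrightarrow> \<exists>D\<in>\<U>. D O D \<subseteq> E"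
proof -
  note u = assms[unfolded is_uniformity_def]
  note u2 = u[THEN conjunct2]
  note u3 = u2[THEN conjunct2, THEN conjunct2]
  show "Z \<times> Z \<in> \<U>" by (rule u[THEN conjunct1])
  show "E \<subseteq> Z \<times> Z" if "E \<in> \<U>"
    by (rule conjunct1[OF bspec[OF u2[THEN conjunct1] that]])
  show "Id_on Z \<subseteq> E" if "E \<in> \<U>"
    by (rule conjunct2[OF bspec[OF u2[THEN conjunct1] that]])
  show "E \<inter> D \<in> \<U>" if "E \<in> \<U>" "D \<in> \<U>"
    by (rule bspec[OF bspec[OF u3[THEN conjunct1] that(1)] that(2)])
  show "E\<inverse> \<in> \<U>" if "E \<in> \<U>"
    by (rule bspec[OF u3[THEN conjunct2, THEN conjunct1] that])
  show "\<exists>D\<in>\<U>. D O D \<subseteq> E" if "E \<in> \<U>"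
    by (rule bspec[OF u3[THEN conjunct2, THEN conjunct2] that])
qed

lemma openin_uniform_topology:
  assumes "is_uniformity Z \<U>"
  shows "openin (uniform_topology Z \<U>) V \<longleftrightarrow> V \<subseteq> Z \<and> (\<forall>z\<in>V. \<exists>E\<in>\<U>. E `` {z} \<subseteq> V)"
proof -
  have "istopology (\<lambda>V. V \<subseteq> Z \<and> (\<forall>z\<in>V. \<exists>E\<in>\<U>. E `` {z} \<subseteq> V))"
    unfolding istopology_def
  proof (intro conjI allI impI ballI)
    fix S T z
    assume S: "S \<subseteq> Z \<and> (\<forall>z\<in>S. \<exists>E\<in>\<U>. E `` {z} \<subseteq> S)"
      and T: "T \<subseteq> Z \<and> (\<forall>z\<in>T. \<exists>E\<in>\<U>. E `` {z} \<subseteq> T)" and z: "z \<in> S \<inter> T"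
    obtain E D where "E \<in> \<U>" "E `` {z} \<subseteq> S" "D \<in> \<U>" "D `` {z} \<subseteq> T"
      using S T z by blast
    then show "\<exists>E\<in>\<U>. E `` {z} \<subseteq> S \<inter> T"
      using is_uniformity_Int[OF assms] by (intro bexI[of _ "E \<inter> D"]) auto
  next
    fix K z
    assume K: "\<forall>S\<in>K. S \<subseteq> Z \<and> (\<forall>z\<in>S. \<exists>E\<in>\<U>. E `` {z} \<subseteq> S)" and z: "z \<in> \<Union>K"
    then obtain S where "S \<in> K" "z \<in> S" by blast
    then obtain E where "E \<in> \<U>" "E `` {z} \<subseteq> S" using K by blast
    then show "\<exists>E\<in>\<U>. E `` {z} \<subseteq> \<Union>K" using \<open>S \<in> K\<close> by blast
  qed blast+
  then show ?thesis
    unfolding uniform_topology_def by simp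
qed

lemma uniform_topology_eqI:
  assumes "is_uniformity Z \<U>"
    and "\<And>V. openin X V \<longleftrightarrow> V \<subseteq> Z \<and> (\<forall>z\<in>V. \<exists>E\<in>\<U>. E `` {z} \<subseteq> V)"
  shows "uniform_topology Z \<U> = X"
  unfolding topology_eq
proof
  fix V show "openin (uniform_topology Z \<U>) V = openin X V"
    unfolding openin_uniform_topology[OF assms(1)] assms(2)[of V] by (rule refl)
qed

lemma topspace_uniform_topology:
  assumes "is_uniformity Z \<U>"
  shows "topspace (uniform_topology Z \<U>) = Z"
proof -
  have "openin (uniform_topology Z \<U>) Z"
    unfolding openin_uniform_topology[OF assms]
    by (auto intro!: bexI[OF _ is_uniformity_carrier[OF assms]])
  moreover have "topspace (uniform_topology Z \<U>) \<subseteq> Z"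
    using openin_topspace[of "uniform_topology Z \<U>"]
    unfolding openin_uniform_topology[OF assms] by (rule conjunct1)
  ultimately show ?thesis
    by (simp add: openin_subset subset_antisym)
qed

lemma is_uniformity_base:
  assumes "B \<noteq> {}"
    and "\<And>e. e \<in> B \<Longrightarrow> e \<subseteq> Z \<times> Z \<and> Id_on Z \<subseteq> e"
    and "\<And>e d. e \<in> B \<Longrightarrow> d \<in> B \<Longrightarrow> \<exists>c\<in>B. c \<subseteq> e \<inter> d"
    and "\<And>e. e \<in> B \<Longrightarrow> \<exists>d\<in>B. d \<subseteq> e\<inverse>"
    and "\<And>e. e \<in> B \<Longrightarrow> \<exists>d\<in>B. d O d \<subseteq> e"
  shows "is_uniformity Z {E. E \<subseteq> Z \<times> Z \<and> (\<exists>e\<in>B. e \<subseteq> E)}"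
  unfolding is_uniformity_def
proof (intro conjI ballI allI impI; (elim CollectE conjE bexE)?)
  show "Z \<times> Z \<in> {E. E \<subseteq> Z \<times> Z \<and> (\<exists>e\<in>B. e \<subseteq> E)}"
    using assms(1,2) by blast
  fix E e assume E: "E \<subseteq> Z \<times> Z" and e: "e \<in> B" "e \<subseteq> E"
  show "E \<subseteq> Z \<times> Z" by fact
  show "Id_on Z \<subseteq> E" using assms(2)[OF e(1)] e(2) by (meson subset_trans)
  show "D \<in> {E. E \<subseteq> Z \<times> Z \<and> (\<exists>e\<in>B. e \<subseteq> E)}" if "E \<subseteq> D" "D \<subseteq> Z \<times> Z" for D
    using that e by blast
  show "E \<inter> D \<in> {E. E \<subseteq> Z \<times> Z \<and> (\<exists>e\<in>B. e \<subseteq> E)}"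
    if D: "D \<subseteq> Z \<times> Z" "d \<in> B" "d \<subseteq> D" for D d
  proof -
    obtain c where "c \<in> B" "c \<subseteq> e \<inter> d" using assms(3)[OF e(1) D(2)] by blast
    moreover have "c \<subseteq> E \<inter> D" using \<open>c \<subseteq> e \<inter> d\<close> e(2) D(3) by blast
    ultimately show ?thesis using E by blast
  qed
  show "E\<inverse> \<in> {E. E \<subseteq> Z \<times> Z \<and> (\<exists>e\<in>B. e \<subseteq> E)}"
  proof -
    obtain d where "d \<in> B" "d \<subseteq> e\<inverse>" using assms(4)[OF e(1)] by blast
    moreover have "d \<subseteq> E\<inverse>" using \<open>d \<subseteq> e\<inverse>\<close> e(2) by blast
    moreover have "E\<inverse> \<subseteq> Z \<times> Z" using E by blast
    ultimately show ?thesis by blast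
  qed
  show "\<exists>D\<in>{E. E \<subseteq> Z \<times> Z \<and> (\<exists>e\<in>B. e \<subseteq> E)}. D O D \<subseteq> E"
  proof -
    obtain d where d: "d \<in> B" "d O d \<subseteq> e" using assms(5)[OF e(1)] by blast
    then have "d \<in> {E. E \<subseteq> Z \<times> Z \<and> (\<exists>e\<in>B. e \<subseteq> E)}" using assms(2)[of d] by blast
    moreover have "d O d \<subseteq> E" using d(2) e(2) by (rule subset_trans)
    ultimately show ?thesis by (rule bexI[rotated])
  qed
qed

lemma completely_regular_imp_compatible_uniformity:
  assumes "completely_regular_space X"
  shows "\<exists>\<U>. compatible_uniformity X \<U>"
proof -
  let ?Z = "topspace X"
  define b where "b F \<epsilon> = {(x, y) \<in> ?Z \<times> ?Z. \<forall>f\<in>F. \<bar>f x - f y\<bar> < \<epsilon>}"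
    for F :: "('a \<Rightarrow> real) set" and \<epsilon> :: real
  define B where "B = {b F \<epsilon> | F \<epsilon>. finite F \<and> (\<forall>f\<in>F. continuous_map X euclideanreal f) \<and> \<epsilon> > 0}"
  define \<U> where "\<U> = {E. E \<subseteq> ?Z \<times> ?Z \<and> (\<exists>e\<in>B. e \<subseteq> E)}"
  have BI: "b F \<epsilon> \<in> B"
    if "finite F" "\<And>f. f \<in> F \<Longrightarrow> continuous_map X euclideanreal f" "\<epsilon> > 0" for F \<epsilon>
    using that unfolding B_def by blast
  have BE: "\<exists>F \<epsilon>. e = b F \<epsilon> \<and> finite F \<and> (\<forall>f\<in>F. continuous_map X euclideanreal f) \<and> \<epsilon> > 0"
    if "e \<in> B" for e
    using that unfolding B_def by blast
  have unif: "is_uniformity ?Z \<U>"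
    unfolding \<U>_def
  proof (rule is_uniformity_base)
    show "B \<noteq> {}" using BI[of "{}" 1] by auto
  next
    fix e assume "e \<in> B"
    then obtain F \<epsilon> where F: "e = b F \<epsilon>" "finite F"
      "\<forall>f\<in>F. continuous_map X euclideanreal f" "\<epsilon> > 0" using BE by blast
    show "e \<subseteq> ?Z \<times> ?Z \<and> Id_on ?Z \<subseteq> e" using F by (auto simp: b_def)
    have "b F \<epsilon> \<subseteq> e\<inverse>" using F(1) by (auto simp: b_def abs_minus_commute)
    then show "\<exists>d\<in>B. d \<subseteq> e\<inverse>" using BI F by blast
    have "b F (\<epsilon>/2) O b F (\<epsilon>/2) \<subseteq> e"
    proof (clarify)
      fix x y z assume "(x, y) \<in> b F (\<epsilon>/2)" "(y, z) \<in> b F (\<epsilon>/2)"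
      then have xz: "x \<in> ?Z" "z \<in> ?Z"
        and "\<And>f. f \<in> F \<Longrightarrow> \<bar>f x - f y\<bar> < \<epsilon>/2 \<and> \<bar>f y - f z\<bar> < \<epsilon>/2" by (auto simp: b_def)
      then have "\<bar>f x - f z\<bar> < \<epsilon>" if "f \<in> F" for f using that by (smt (verit) field_sum_of_halves)
      then show "(x, z) \<in> e" unfolding F(1) b_def using xz by blast
    qed
    moreover have "b F (\<epsilon>/2) \<in> B" using BI F by simp
    ultimately show "\<exists>d\<in>B. d O d \<subseteq> e" by blast
    fix d assume "d \<in> B"
    then obtain F' \<epsilon>' where F': "d = b F' \<epsilon>'" "finite F'"
      "\<forall>f\<in>F'. continuous_map X euclideanreal f" "\<epsilon>' > 0" using BE by blast
    have "b (F \<union> F') (min \<epsilon> \<epsilon>') \<in> B" by (rule BI) (use F F' in auto)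
    moreover have "b (F \<union> F') (min \<epsilon> \<epsilon>') \<subseteq> e \<inter> d" using F(1) F'(1) by (auto simp: b_def)
    ultimately show "\<exists>c\<in>B. c \<subseteq> e \<inter> d" by blast
  qed
  have "uniform_topology ?Z \<U> = X"
  proof (rule uniform_topology_eqI[OF unif], intro iffI conjI ballI)
    fix V assume V: "openin X V"
    show "V \<subseteq> ?Z" using V by (rule openin_subset)
    fix z assume z: "z \<in> V"
    have "closedin X (?Z - V)" "z \<in> ?Z - (?Z - V)"
      using V z openin_subset by fastforce+
    then obtain f where f: "continuous_map X (top_of_set {0..1::real}) f" "f z = 0"
      "f ` (?Z - V) \<subseteq> {1}"
      using assms unfolding completely_regular_space_def by meson
    have "continuous_map X euclideanreal f"
      using f(1) by (simp add: continuous_map_in_subtopology)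
    then have "b {f} 1 \<in> B" by (intro BI) auto
    moreover have "b {f} 1 \<subseteq> ?Z \<times> ?Z" by (auto simp: b_def)
    ultimately have "b {f} 1 \<in> \<U>" unfolding \<U>_def by blast
    moreover have "b {f} 1 `` {z} \<subseteq> V" using f(2,3) by (auto simp: b_def)
    ultimately show "\<exists>E\<in>\<U>. E `` {z} \<subseteq> V" by blast
  next
    fix V assume V: "V \<subseteq> ?Z \<and> (\<forall>z\<in>V. \<exists>E\<in>\<U>. E `` {z} \<subseteq> V)"
    show "openin X V"
    proof (subst openin_subopen, intro ballI)
      fix z assume z: "z \<in> V"
      then obtain E where "E \<in> \<U>" "E `` {z} \<subseteq> V" using V by blast
      then obtain e where "e \<in> B" "e `` {z} \<subseteq> V" unfolding \<U>_def by blast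
      then obtain F \<epsilon> where F: "b F \<epsilon> `` {z} \<subseteq> V" "finite F"
        "\<forall>f\<in>F. continuous_map X euclideanreal f" "\<epsilon> > 0" using BE by blast
      have zZ: "z \<in> ?Z" using V z by blast
      define W where "W = (\<Inter>f\<in>F. {y \<in> ?Z. f y \<in> ball (f z) \<epsilon>}) \<inter> ?Z"
      have "openin X W"
      proof (cases "F = {}")
        case False
        have "openin X (\<Inter>f\<in>F. {y \<in> ?Z. f y \<in> ball (f z) \<epsilon>})"
          using False F(2,3) by (intro openin_INT2 openin_continuous_map_preimage) auto
        then show ?thesis unfolding W_def by blast
      qed (simp add: W_def)
      moreover have "z \<in> W" using zZ F(4) by (auto simp: W_def)
      moreover have "W \<subseteq> b F \<epsilon> `` {z}" using zZ by (auto simp: W_def b_def dist_real_def)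
      ultimately show "\<exists>T. openin X T \<and> z \<in> T \<and> T \<subseteq> V" using F(1) by blast
    qed
  qed
  then show ?thesis using unif unfolding compatible_uniformity_def by blast
qed

lemma universal_uniformity_exists:
  assumes "completely_regular_space X"
  shows "\<exists>!\<U>. compatible_uniformity X \<U> \<and> (\<forall>\<V>. compatible_uniformity X \<V> \<longrightarrow> \<V> \<subseteq> \<U>)"
proof -
  let ?Z = "topspace X"
  define C where "C = \<Union>{\<V>. compatible_uniformity X \<V>}"
  define B where "B = {?Z \<times> ?Z \<inter> \<Inter>F | F. finite F \<and> F \<subseteq> C}"
  define \<U> where "\<U> = {E. E \<subseteq> ?Z \<times> ?Z \<and> (\<exists>e\<in>B. e \<subseteq> E)}"
  have C: "e \<subseteq> ?Z \<times> ?Z \<and> Id_on ?Z \<subseteq> e \<and> e\<inverse> \<in> C \<and> (\<exists>d\<in>C. d O d \<subseteq> e)" if eC: "e \<in> C" for e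
  proof -
    obtain \<V> where V: "compatible_uniformity X \<V>" "e \<in> \<V>" using eC unfolding C_def by blast
    then have *: "is_uniformity ?Z \<V>" by (simp add: compatible_uniformity_def)
    have sub: "\<V> \<subseteq> C" using V(1) unfolding C_def by blast
    obtain d where "d \<in> \<V>" "d O d \<subseteq> e" using is_uniformity_half[OF * V(2)] by blast
    then have "\<exists>d\<in>C. d O d \<subseteq> e" using sub by blast
    moreover have "e\<inverse> \<in> C" using is_uniformity_converse[OF * V(2)] sub by blast
    ultimately show ?thesis
      using is_uniformity_subset[OF * V(2)] is_uniformity_refl[OF * V(2)] by simp
  qed
  have BI: "?Z \<times> ?Z \<inter> \<Inter>F \<in> B" if "finite F" "F \<subseteq> C" for F
    using that unfolding B_def by blast
  have unif: "is_uniformity ?Z \<U>"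
    unfolding \<U>_def
  proof (rule is_uniformity_base)
    show "B \<noteq> {}" using BI[of "{}"] by auto
  next
    fix e assume "e \<in> B"
    then obtain F where F: "e = ?Z \<times> ?Z \<inter> \<Inter>F" "finite F" "F \<subseteq> C" unfolding B_def by blast
    have "Id_on ?Z \<subseteq> f" if "f \<in> F" for f using C[of f] F(3) that by (meson subsetD)
    then show "e \<subseteq> ?Z \<times> ?Z \<and> Id_on ?Z \<subseteq> e" unfolding F(1) by blast
    have "?Z \<times> ?Z \<inter> \<Inter>(converse ` F) \<in> B" using F C by (intro BI) auto
    moreover have "?Z \<times> ?Z \<inter> \<Inter>(converse ` F) \<subseteq> e\<inverse>" using F(1) by blast
    ultimately show "\<exists>d\<in>B. d \<subseteq> e\<inverse>" by blast
    obtain h where h: "\<And>e. e \<in> C \<Longrightarrow> h e \<in> C \<and> h e O h e \<subseteq> e" using C by metis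
    have "?Z \<times> ?Z \<inter> \<Inter>(h ` F) \<in> B" using F h by (intro BI) auto
    moreover have "(?Z \<times> ?Z \<inter> \<Inter>(h ` F)) O (?Z \<times> ?Z \<inter> \<Inter>(h ` F)) \<subseteq> e"
    proof (clarify)
      fix x y z
      assume xyz: "(x, y) \<in> \<Inter>(h ` F)" "(y, z) \<in> \<Inter>(h ` F)" "x \<in> ?Z" "z \<in> ?Z"
      have "(x, z) \<in> f" if "f \<in> F" for f
      proof -
        have "(x, z) \<in> h f O h f" using xyz that by blast
        then show ?thesis using h F(3) that by blast
      qed
      then show "(x, z) \<in> e" using F(1) xyz by blast
    qed
    ultimately show "\<exists>d\<in>B. d O d \<subseteq> e" by blast
    fix d assume "d \<in> B"
    then obtain F' where F': "d = ?Z \<times> ?Z \<inter> \<Inter>F'" "finite F'" "F' \<subseteq> C" unfolding B_def by blast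
    have "?Z \<times> ?Z \<inter> \<Inter>(F \<union> F') \<in> B" using F F' by (intro BI) auto
    moreover have "?Z \<times> ?Z \<inter> \<Inter>(F \<union> F') \<subseteq> e \<inter> d" using F(1) F'(1) by blast
    ultimately show "\<exists>c\<in>B. c \<subseteq> e \<inter> d" by blast
  qed
  have CU: "e \<in> \<U>" if "e \<in> C" for e
  proof -
    have "?Z \<times> ?Z \<inter> \<Inter>{e} \<in> B" using that by (intro BI) auto
    moreover have "?Z \<times> ?Z \<inter> \<Inter>{e} = e" using C that by auto
    ultimately show ?thesis using C that unfolding \<U>_def by auto
  qed
  have opn: "openin X V \<longleftrightarrow> V \<subseteq> ?Z \<and> (\<forall>z\<in>V. \<exists>E\<in>\<V>. E `` {z} \<subseteq> V)"
    if "compatible_uniformity X \<V>" for \<V> V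
    using that openin_uniform_topology[of ?Z \<V> V] unfolding compatible_uniformity_def by simp
  obtain \<V>0 where \<V>0: "compatible_uniformity X \<V>0"
    using completely_regular_imp_compatible_uniformity[OF assms] by blast
  have "uniform_topology ?Z \<U> = X"
  proof (rule uniform_topology_eqI[OF unif], intro iffI)
    fix V assume "openin X V"
    then have "V \<subseteq> ?Z \<and> (\<forall>z\<in>V. \<exists>E\<in>\<V>0. E `` {z} \<subseteq> V)" using opn[OF \<V>0] by blast
    moreover have "\<V>0 \<subseteq> \<U>" using CU \<V>0 unfolding C_def by blast
    ultimately show "V \<subseteq> ?Z \<and> (\<forall>z\<in>V. \<exists>E\<in>\<U>. E `` {z} \<subseteq> V)" by blast
  next
    fix V assume V: "V \<subseteq> ?Z \<and> (\<forall>z\<in>V. \<exists>E\<in>\<U>. E `` {z} \<subseteq> V)"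
    show "openin X V"
    proof (subst openin_subopen, intro ballI)
      fix z assume z: "z \<in> V"
      then have zZ: "z \<in> ?Z" using V by blast
      obtain E where "E \<in> \<U>" "E `` {z} \<subseteq> V" using V z by blast
      then obtain e where "e \<in> B" "e `` {z} \<subseteq> V" unfolding \<U>_def by blast
      then obtain F where F: "(?Z \<times> ?Z \<inter> \<Inter>F) `` {z} \<subseteq> V" "finite F" "F \<subseteq> C"
        unfolding B_def by blast
      have "\<exists>W. openin X W \<and> z \<in> W \<and> W \<subseteq> f `` {z}" if "f \<in> F" for f
      proof -
        obtain \<V> where \<V>: "compatible_uniformity X \<V>" "f \<in> \<V>" using F(3) \<open>f \<in> F\<close> unfolding C_def by blast
        then have u: "is_uniformity ?Z \<V>" by (simp add: compatible_uniformity_def)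
        define W where "W = {y \<in> ?Z. \<exists>D\<in>\<V>. D `` {y} \<subseteq> f `` {z}}"
        have "openin X W"
          unfolding opn[OF \<V>(1)]
        proof (intro conjI ballI)
          show "W \<subseteq> ?Z" by (auto simp: W_def)
          fix y assume "y \<in> W"
          then obtain D where D: "D \<in> \<V>" "D `` {y} \<subseteq> f `` {z}" by (auto simp: W_def)
          obtain D' where D': "D' \<in> \<V>" "D' O D' \<subseteq> D"
            using is_uniformity_half[OF u D(1)] by blast
          have "D' \<subseteq> ?Z \<times> ?Z" using u D'(1) by (rule is_uniformity_subset)
          then have "D' `` {y} \<subseteq> W" using D D' unfolding W_def by blast
          then show "\<exists>E\<in>\<V>. E `` {y} \<subseteq> W" using D'(1) by blast
        qed
        moreover have "z \<in> W" using \<V>(2) zZ by (auto simp: W_def)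
        moreover have "W \<subseteq> f `` {z}"
        proof
          fix y assume "y \<in> W"
          then obtain D where "y \<in> ?Z" "D \<in> \<V>" "D `` {y} \<subseteq> f `` {z}" by (auto simp: W_def)
          then show "y \<in> f `` {z}" using is_uniformity_refl[OF u] by blast
        qed
        ultimately show ?thesis by blast
      qed
      then obtain W where W: "\<And>f. f \<in> F \<Longrightarrow> openin X (W f) \<and> z \<in> W f \<and> W f \<subseteq> f `` {z}"
        by metis
      have "openin X (?Z \<inter> \<Inter>(W ` F))"
      proof (cases "F = {}")
        case False
        then have "openin X (\<Inter>(W ` F))" using F(2) W by (intro openin_Inter) auto
        then show ?thesis by blast
      qed simp
      moreover have "z \<in> ?Z \<inter> \<Inter>(W ` F)" using W zZ by blast
      moreover have "?Z \<inter> \<Inter>(W ` F) \<subseteq> V" using W F(1) zZ by blast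
      ultimately show "\<exists>T. openin X T \<and> z \<in> T \<and> T \<subseteq> V" by blast
    qed
  qed
  then have 1: "compatible_uniformity X \<U>" using unif unfolding compatible_uniformity_def by blast
  moreover have 2: "\<forall>\<V>. compatible_uniformity X \<V> \<longrightarrow> \<V> \<subseteq> \<U>" using CU unfolding C_def by blast
  ultimately show ?thesis by (intro ex1I[of _ \<U>]) (auto dest: subset_antisym)
qed

lemma universal_uniformity:
  assumes "completely_regular_space X"
  shows "compatible_uniformity X (universal_uniformity X)"
    and "compatible_uniformity X \<V> \<Longrightarrow> \<V> \<subseteq> universal_uniformity X"
  using theI'[OF universal_uniformity_exists[OF assms]]
  unfolding universal_uniformity_def by blast+


subsection \<open>Topological groups\<close>

lemma continuous_map_group_div:
  assumes "topological_group G T" "continuous_map Y T f" "continuous_map Y T g"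
  shows "continuous_map Y T (\<lambda>x. f x \<otimes>\<^bsub>G\<^esub> inv\<^bsub>G\<^esub> g x)"
proof -
  have m: "continuous_map (prod_topology T T) T (\<lambda>(x, y). x \<otimes>\<^bsub>G\<^esub> y)"
    and i: "continuous_map T T (\<lambda>x. inv\<^bsub>G\<^esub> x)"
    using assms(1) unfolding topological_group_def by auto
  have "continuous_map Y T (\<lambda>x. inv\<^bsub>G\<^esub> g x)"
    using continuous_map_compose[OF assms(3) i] by (simp add: o_def)
  then have "continuous_map Y (prod_topology T T) (\<lambda>x. (f x, inv\<^bsub>G\<^esub> g x))"
    using assms(2) by (simp add: continuous_map_pairedI)
  from continuous_map_compose[OF this m] show ?thesis by (simp add: o_def)
qed

lemma topological_groupI:
  assumes "group G" "topspace T = carrier G"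
    and d: "continuous_map (prod_topology T T) T (\<lambda>(x, y). x \<otimes>\<^bsub>G\<^esub> inv\<^bsub>G\<^esub> y)"
  shows "topological_group G T"
proof -
  interpret group G by fact
  have inv: "continuous_map T T (\<lambda>x. inv\<^bsub>G\<^esub> x)"
  proof -
    have "continuous_map T (prod_topology T T) (\<lambda>x. (\<one>\<^bsub>G\<^esub>, x))"
      using assms(2) by (simp add: continuous_map_pairedI)
    from continuous_map_compose[OF this d]
    have "continuous_map T T (\<lambda>x. \<one>\<^bsub>G\<^esub> \<otimes>\<^bsub>G\<^esub> inv\<^bsub>G\<^esub> x)" by (simp add: o_def)
    then show ?thesis by (rule continuous_map_eq) (simp add: assms(2))
  qed
  have "continuous_map (prod_topology T T) T (\<lambda>p. inv\<^bsub>G\<^esub> snd p)"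
    using continuous_map_compose[OF continuous_map_snd inv] by (simp add: o_def)
  then have "continuous_map (prod_topology T T) (prod_topology T T) (\<lambda>p. (fst p, inv\<^bsub>G\<^esub> snd p))"
    by (simp add: continuous_map_pairedI continuous_map_fst)
  from continuous_map_compose[OF this d]
  have "continuous_map (prod_topology T T) T (\<lambda>p. fst p \<otimes>\<^bsub>G\<^esub> inv\<^bsub>G\<^esub> (inv\<^bsub>G\<^esub> snd p))"
    by (simp add: o_def)
  then have "continuous_map (prod_topology T T) T (\<lambda>(x, y). x \<otimes>\<^bsub>G\<^esub> y)"
    by (rule continuous_map_eq) (auto simp: assms(2))
  then show ?thesis using assms inv unfolding topological_group_def by blast
qed

lemma compatible_right_uniformity:
  assumes "topological_group G T"
  shows "compatible_uniformity T (right_uniformity G T)"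
proof -
  interpret group G using assms by (simp add: topological_group_def)
  have top: "topspace T = carrier G" using assms by (simp add: topological_group_def)
  define b where "b U = {(x, y) \<in> carrier G \<times> carrier G. x \<otimes>\<^bsub>G\<^esub> inv\<^bsub>G\<^esub> y \<in> U}" for U
  define B where "B = {b U | U. openin T U \<and> \<one>\<^bsub>G\<^esub> \<in> U}"
  have R: "right_uniformity G T = {E. E \<subseteq> carrier G \<times> carrier G \<and> (\<exists>e\<in>B. e \<subseteq> E)}"
    unfolding right_uniformity_def B_def b_def by blast
  have BI: "b U \<in> B" if "openin T U" "\<one>\<^bsub>G\<^esub> \<in> U" for U using that unfolding B_def by blast
  have unif: "is_uniformity (carrier G) (right_uniformity G T)"
    unfolding R
  proof (rule is_uniformity_base)
    show "B \<noteq> {}" using BI[OF openin_topspace] top by auto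
  next
    fix e assume "e \<in> B"
    then obtain U where U: "e = b U" "openin T U" "\<one>\<^bsub>G\<^esub> \<in> U" unfolding B_def by blast
    show "e \<subseteq> carrier G \<times> carrier G \<and> Id_on (carrier G) \<subseteq> e" using U by (auto simp: b_def)
    show "\<exists>d\<in>B. d \<subseteq> e\<inverse>"
    proof -
      let ?V = "{x \<in> topspace T. inv\<^bsub>G\<^esub> x \<in> U}"
      have "openin T ?V"
        using assms U(2) unfolding topological_group_def
        by (intro openin_continuous_map_preimage) auto
      then have "b ?V \<in> B" using U(3) top by (intro BI) auto
      moreover have "b ?V \<subseteq> e\<inverse>"
        unfolding U(1) b_def by (auto simp: inv_mult_group)
      ultimately show ?thesis by blast
    qed
    show "\<exists>d\<in>B. d O d \<subseteq> e"
    proof -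
      define P where "P = {p \<in> topspace (prod_topology T T). (\<lambda>(x, y). x \<otimes>\<^bsub>G\<^esub> y) p \<in> U}"
      have "openin (prod_topology T T) P"
        using assms U(2) unfolding topological_group_def P_def
        by (intro openin_continuous_map_preimage) auto
      moreover have "(\<one>\<^bsub>G\<^esub>, \<one>\<^bsub>G\<^esub>) \<in> P" using top U(3) by (simp add: P_def)
      ultimately obtain V W where VW: "openin T V" "openin T W" "\<one>\<^bsub>G\<^esub> \<in> V" "\<one>\<^bsub>G\<^esub> \<in> W" "V \<times> W \<subseteq> P"
        unfolding openin_prod_topology_alt by meson
      have "b (V \<inter> W) \<in> B" using VW by (intro BI) auto
      moreover have "b (V \<inter> W) O b (V \<inter> W) \<subseteq> e"
      proof (clarify)
        fix x y z assume xy: "(x, y) \<in> b (V \<inter> W)" and yz: "(y, z) \<in> b (V \<inter> W)"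
        then have c: "x \<in> carrier G" "y \<in> carrier G" "z \<in> carrier G" by (auto simp: b_def)
        have "(x \<otimes>\<^bsub>G\<^esub> inv\<^bsub>G\<^esub> y, y \<otimes>\<^bsub>G\<^esub> inv\<^bsub>G\<^esub> z) \<in> V \<times> W" using xy yz by (auto simp: b_def)
        then have "(x \<otimes>\<^bsub>G\<^esub> inv\<^bsub>G\<^esub> y) \<otimes>\<^bsub>G\<^esub> (y \<otimes>\<^bsub>G\<^esub> inv\<^bsub>G\<^esub> z) \<in> U"
          using VW(5) unfolding P_def by auto
        moreover have "(x \<otimes>\<^bsub>G\<^esub> inv\<^bsub>G\<^esub> y) \<otimes>\<^bsub>G\<^esub> (y \<otimes>\<^bsub>G\<^esub> inv\<^bsub>G\<^esub> z) = x \<otimes>\<^bsub>G\<^esub> inv\<^bsub>G\<^esub> z"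
          using c by (metis inv_closed inv_solve_left m_assoc m_closed)
        ultimately show "(x, z) \<in> e" using c U(1) by (simp add: b_def)
      qed
      ultimately show ?thesis by blast
    qed
    fix d assume "d \<in> B"
    then obtain V where V: "d = b V" "openin T V" "\<one>\<^bsub>G\<^esub> \<in> V" unfolding B_def by blast
    have "b (U \<inter> V) \<in> B" using U V by (intro BI) auto
    moreover have "b (U \<inter> V) \<subseteq> e \<inter> d" using U(1) V(1) by (auto simp: b_def)
    ultimately show "\<exists>c\<in>B. c \<subseteq> e \<inter> d" by blast
  qed
  have "uniform_topology (carrier G) (right_uniformity G T) = T"
  proof (rule uniform_topology_eqI[OF unif], intro iffI conjI ballI)
    fix V assume V: "openin T V"
    show VG: "V \<subseteq> carrier G" using openin_subset[OF V] top by simp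
    fix z assume z: "z \<in> V"
    then have zG: "z \<in> carrier G" using VG by blast
    let ?U = "{x \<in> topspace T. (inv\<^bsub>G\<^esub> x) \<otimes>\<^bsub>G\<^esub> z \<in> V}"
    have "continuous_map T T (\<lambda>x. inv\<^bsub>G\<^esub> x)" using assms by (simp add: topological_group_def)
    moreover have "continuous_map T T (\<lambda>x. inv\<^bsub>G\<^esub> z)" using zG top by simp
    ultimately have "continuous_map T T (\<lambda>x. inv\<^bsub>G\<^esub> x \<otimes>\<^bsub>G\<^esub> inv\<^bsub>G\<^esub> (inv\<^bsub>G\<^esub> z))"
      by (rule continuous_map_group_div[OF assms])
    then have "openin T ?U" using V zG by (intro openin_continuous_map_preimage) auto
    then have "b ?U \<in> B" using z zG top by (intro BI) auto
    moreover have "b ?U \<subseteq> carrier G \<times> carrier G" by (auto simp: b_def)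
    ultimately have "b ?U \<in> right_uniformity G T" unfolding R by blast
    moreover have "b ?U `` {z} \<subseteq> V"
    proof
      fix y assume "y \<in> b ?U `` {z}"
      then have y: "y \<in> carrier G" "inv\<^bsub>G\<^esub> (z \<otimes>\<^bsub>G\<^esub> inv\<^bsub>G\<^esub> y) \<otimes>\<^bsub>G\<^esub> z \<in> V"
        by (simp_all add: b_def)
      have "inv\<^bsub>G\<^esub> (z \<otimes>\<^bsub>G\<^esub> inv\<^bsub>G\<^esub> y) \<otimes>\<^bsub>G\<^esub> z = y" using y(1) zG by (simp add: inv_mult_group m_assoc)
      then show "y \<in> V" using y(2) by simp
    qed
    ultimately show "\<exists>E\<in>right_uniformity G T. E `` {z} \<subseteq> V" by blast
  next
    fix V assume V: "V \<subseteq> carrier G \<and> (\<forall>z\<in>V. \<exists>E\<in>right_uniformity G T. E `` {z} \<subseteq> V)"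
    show "openin T V"
    proof (subst openin_subopen, intro ballI)
      fix z assume z: "z \<in> V"
      then have zG: "z \<in> carrier G" using V by blast
      obtain E where "E \<in> right_uniformity G T" "E `` {z} \<subseteq> V" using V z by blast
      then obtain U where U: "openin T U" "\<one>\<^bsub>G\<^esub> \<in> U" "b U `` {z} \<subseteq> V"
        unfolding R B_def by blast
      let ?W = "{y \<in> topspace T. z \<otimes>\<^bsub>G\<^esub> inv\<^bsub>G\<^esub> y \<in> U}"
      have "continuous_map T T (\<lambda>y. z \<otimes>\<^bsub>G\<^esub> inv\<^bsub>G\<^esub> y)"
        by (rule continuous_map_group_div[OF assms]) (use zG top in auto)
      then have "openin T ?W" using U by (intro openin_continuous_map_preimage) auto
      moreover have "z \<in> ?W" using zG top U by simp
      moreover have "?W \<subseteq> V" using U(3) zG top by (auto simp: b_def)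
      ultimately show "\<exists>T'. openin T T' \<and> z \<in> T' \<and> T' \<subseteq> V" by blast
    qed
  qed
  then show ?thesis using unif top unfolding compatible_uniformity_def by simp
qed

lemma topological_group_product:
  assumes "\<And>i. i \<in> I \<Longrightarrow> topological_group (G i) (T i)"
  shows "topological_group (product_group I G) (product_topology T I)"
proof (rule topological_groupI)
  have g: "\<And>i. i \<in> I \<Longrightarrow> group (G i)" and t: "\<And>i. i \<in> I \<Longrightarrow> topspace (T i) = carrier (G i)"
    using assms by (auto simp: topological_group_def)
  show "group (product_group I G)" using g by simp
  show top: "topspace (product_topology T I) = carrier (product_group I G)"
    using t by (auto simp: PiE_iff)
  let ?P = "prod_topology (product_topology T I) (product_topology T I)"
  have "continuous_map ?P (product_topology T I)
          (\<lambda>p. \<lambda>i\<in>I. fst p i \<otimes>\<^bsub>G i\<^esub> inv\<^bsub>G i\<^esub> snd p i)"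
    unfolding continuous_map_componentwise
  proof (intro conjI ballI)
    fix i assume i: "i \<in> I"
    have "continuous_map ?P (T i) (\<lambda>p. fst p i)" "continuous_map ?P (T i) (\<lambda>p. snd p i)"
      using continuous_map_compose[OF continuous_map_fst continuous_map_product_projection[OF i]]
            continuous_map_compose[OF continuous_map_snd continuous_map_product_projection[OF i]]
      by (simp_all add: o_def)
    from continuous_map_group_div[OF assms[OF i] this] i
    show "continuous_map ?P (T i) (\<lambda>p. (\<lambda>i\<in>I. fst p i \<otimes>\<^bsub>G i\<^esub> inv\<^bsub>G i\<^esub> snd p i) i)"
      by simp
  qed auto
  then show "continuous_map ?P (product_topology T I)
      (\<lambda>(x, y). x \<otimes>\<^bsub>product_group I G\<^esub> inv\<^bsub>product_group I G\<^esub> y)"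
    by (rule continuous_map_eq) (use g t in \<open>auto simp: top PiE_iff intro!: restrict_ext\<close>)
qed

lemma generate_le_words:
  fixes H :: "('h, 'm) monoid_scheme" and f :: "'a \<Rightarrow> 'h"
  assumes "group H" "f ` Z \<subseteq> carrier H"
  obtains c :: "'h \<Rightarrow> (bool \<times> 'a) list set" where "inj_on c (generate H (f ` Z))"
proof -
  interpret group H by fact
  define l where "l p = (if fst p then f (snd p) else inv\<^bsub>H\<^esub> f (snd p))" for p :: "bool \<times> 'a"
  define ev where "ev w = foldr (\<lambda>p a. l p \<otimes>\<^bsub>H\<^esub> a) w \<one>\<^bsub>H\<^esub>" for w
  have l: "l p \<in> carrier H" if "snd p \<in> Z" for p using that assms(2) by (auto simp: l_def)
  have evc: "ev w \<in> carrier H" if "set w \<subseteq> UNIV \<times> Z" for w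
    using that by (induction w) (auto simp: ev_def intro!: m_closed l)
  have app: "ev (u @ w) = ev u \<otimes>\<^bsub>H\<^esub> ev w"
    if "set u \<subseteq> UNIV \<times> Z" "set w \<subseteq> UNIV \<times> Z" for u w
    using that(1)
  proof (induction u)
    case Nil
    then show ?case using evc[OF that(2)] by (simp add: ev_def)
  next
    case (Cons p u)
    have "ev (p # u @ w) = l p \<otimes>\<^bsub>H\<^esub> (ev u \<otimes>\<^bsub>H\<^esub> ev w)" using Cons by (simp add: ev_def)
    also have "\<dots> = l p \<otimes>\<^bsub>H\<^esub> ev u \<otimes>\<^bsub>H\<^esub> ev w"
      using Cons.prems l[of p] evc[of u] evc[OF that(2)] by (auto simp: m_assoc)
    finally show ?case by (simp add: ev_def)
  qed
  have "\<exists>w. set w \<subseteq> UNIV \<times> Z \<and> ev w = y" if "y \<in> generate H (f ` Z)" for y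
    using that
  proof induction
    case one
    show ?case by (rule exI[of _ "[]"]) (simp add: ev_def)
  next
    case (incl h)
    then obtain x where "x \<in> Z" "h = f x" by blast
    then show ?case using assms(2)
      by (intro exI[of _ "[(True, x)]"]) (auto simp: ev_def l_def)
  next
    case (inv h)
    then obtain x where "x \<in> Z" "h = f x" by blast
    then show ?case using assms(2)
      by (intro exI[of _ "[(False, x)]"]) (auto simp: ev_def l_def)
  next
    case (eng h1 h2)
    then obtain u w where "set u \<subseteq> UNIV \<times> Z" "ev u = h1" "set w \<subseteq> UNIV \<times> Z" "ev w = h2" by blast
    then show ?case using app by (intro exI[of _ "u @ w"]) auto
  qed
  then have "inj_on (\<lambda>y. {w. ev w = y}) (generate H (f ` Z))"
    by (intro inj_onI) blast
  then show ?thesis using that by blast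
qed

text \<open>Any topological group receiving \<open>X\<close> factors through one on the word type.\<close>

lemma topological_group_transfer:
  fixes H :: "('h, 'm) monoid_scheme" and f :: "'a \<Rightarrow> 'h"
  assumes H: "topological_group H S" and f: "continuous_map X S f"
  obtains H' :: "(bool \<times> 'a) list set monoid" and S' f' d where
    "topological_group H' S'" "comm_group H \<Longrightarrow> comm_group H'" "continuous_map X S' f'"
    "d \<in> hom H' H" "continuous_map S' S d" "\<And>x. x \<in> topspace X \<Longrightarrow> d (f' x) = f x"
proof -
  interpret group H using H by (simp add: topological_group_def)
  have top: "topspace S = carrier H" using H by (simp add: topological_group_def)
  have fc: "f ` topspace X \<subseteq> carrier H" using f top continuous_map_image_subset_topspace by metis
  define C where "C = generate H (f ` topspace X)"
  have sub: "subgroup C H" unfolding C_def by (rule generate_is_subgroup[OF fc])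
  have CH: "C \<subseteq> carrier H" by (rule subgroup.subset[OF sub])
  obtain c :: "'h \<Rightarrow> (bool \<times> 'a) list set" where c: "inj_on c C"
    using generate_le_words[OF is_group fc] unfolding C_def by blast
  define d where "d = inv_into C c"
  have dc: "d (c y) = y" if "y \<in> C" for y unfolding d_def using c that by simp
  define H' where "H' = \<lparr>carrier = c ` C, monoid.mult = (\<lambda>a b. c (d a \<otimes>\<^bsub>H\<^esub> d b)), one = c \<one>\<^bsub>H\<^esub>\<rparr>"
  define S' where "S' = pullback_topology (c ` C) d S"
  have H'[simp]: "carrier H' = c ` C" "a \<otimes>\<^bsub>H'\<^esub> b = c (d a \<otimes>\<^bsub>H\<^esub> d b)" "\<one>\<^bsub>H'\<^esub> = c \<one>\<^bsub>H\<^esub>" for a b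
    by (simp_all add: H'_def)
  have C1: "\<one>\<^bsub>H\<^esub> \<in> C" "\<And>x y. x \<in> C \<Longrightarrow> y \<in> C \<Longrightarrow> x \<otimes>\<^bsub>H\<^esub> y \<in> C" "\<And>x. x \<in> C \<Longrightarrow> inv\<^bsub>H\<^esub> x \<in> C"
    using sub by (auto simp: subgroup.one_closed subgroup.m_closed subgroup.m_inv_closed)
  have CG: "\<And>x. x \<in> C \<Longrightarrow> x \<in> carrier H" using CH by blast
  have grp: "group H'"
  proof (rule groupI)
    fix x assume "x \<in> carrier H'"
    then obtain y where "y \<in> C" "x = c y" by auto
    then show "\<exists>y\<in>carrier H'. y \<otimes>\<^bsub>H'\<^esub> x = \<one>\<^bsub>H'\<^esub>"
      using C1 CG by (intro bexI[of _ "c (inv\<^bsub>H\<^esub> y)"]) (auto simp: dc)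
  qed (use C1 CG in \<open>auto simp: dc m_assoc\<close>)
  have comm: "comm_group H'" if "comm_group H"
  proof -
    interpret H: comm_group H by fact
    show ?thesis using grp by (rule group.group_comm_groupI) (use CG in \<open>auto simp: dc H.m_comm\<close>)
  qed
  have hom: "d \<in> hom H' H" unfolding hom_def using C1 CG by (auto simp: dc)
  have inv': "inv\<^bsub>H'\<^esub> a = c (inv\<^bsub>H\<^esub> d a)" if "a \<in> c ` C" for a
  proof -
    obtain y where y: "y \<in> C" "a = c y" using \<open>a \<in> c ` C\<close> by blast
    have "c (inv\<^bsub>H\<^esub> y) \<otimes>\<^bsub>H'\<^esub> c y = \<one>\<^bsub>H'\<^esub>" using y(1) C1 CG by (simp add: dc)
    moreover have "c y \<in> carrier H'" "c (inv\<^bsub>H\<^esub> y) \<in> carrier H'" using y(1) C1 by simp_all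
    ultimately have "inv\<^bsub>H'\<^esub> (c y) = c (inv\<^bsub>H\<^esub> y)" by (rule group.inv_equality[OF grp])
    then show ?thesis using y by (simp add: dc)
  qed
  have top': "topspace S' = c ` C"
    unfolding S'_def topspace_pullback_topology using CG top by (auto simp: dc)
  have dcont: "continuous_map S' S d"
    unfolding S'_def by (metis continuous_map_id continuous_map_pullback fun.map_id comp_id)
  have lift: "continuous_map Y S' g"
    if "continuous_map Y S (d \<circ> g)" "g ` topspace Y \<subseteq> c ` C" for Y :: "'z topology" and g
    unfolding S'_def
  proof (rule continuous_map_pullback'[OF that(1)])
    show "topspace Y \<subseteq> g -` (c ` C)" using that(2) by (simp add: image_subset_iff_subset_vimage)
  qed
  have tg: "topological_group H' S'"
  proof (rule topological_groupI[OF grp])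
    show "topspace S' = carrier H'" by (simp add: top')
    have "continuous_map (prod_topology S' S') S (\<lambda>p. d (fst p) \<otimes>\<^bsub>H\<^esub> inv\<^bsub>H\<^esub> d (snd p))"
      by (rule continuous_map_group_div[OF H])
        (use continuous_map_compose[OF continuous_map_fst dcont]
             continuous_map_compose[OF continuous_map_snd dcont] in \<open>simp_all add: o_def\<close>)
    then have "continuous_map (prod_topology S' S') S
        (d \<circ> (\<lambda>(x, y). x \<otimes>\<^bsub>H'\<^esub> inv\<^bsub>H'\<^esub> y))"
      by (rule continuous_map_eq) (use C1 in \<open>auto simp: top' inv' dc\<close>)
    then show "continuous_map (prod_topology S' S') S' (\<lambda>(x, y). x \<otimes>\<^bsub>H'\<^esub> inv\<^bsub>H'\<^esub> y)"
      by (rule lift) (use C1 in \<open>auto simp: top' inv' dc\<close>)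
  qed
  have fC: "f x \<in> C" if "x \<in> topspace X" for x
    unfolding C_def using that by (intro generate.incl) auto
  have f'cont: "continuous_map X S' (c \<circ> f)"
  proof (rule lift)
    show "continuous_map X S (d \<circ> (c \<circ> f))"
      by (rule continuous_map_eq[OF f]) (use fC in \<open>auto simp: dc\<close>)
  qed (use fC in auto)
  show ?thesis
    by (rule that[OF tg comm f'cont hom dcont]) (use fC in \<open>auto simp: dc\<close>)
qed

lemma free_topological_group_extend:
  fixes H :: "('h, 'k) monoid_scheme"
  assumes "free_topological_group X G T \<eta>" "topological_group H S" "continuous_map X S f"
  shows "\<exists>h \<in> hom G H. continuous_map T S h \<and> (\<forall>x\<in>topspace X. h (\<eta> x) = f x)"
proof -
  obtain H' :: "(bool \<times> 'a) list set monoid" and S' f' d where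
    *: "topological_group H' S'" "continuous_map X S' f'"
    "d \<in> hom H' H" "continuous_map S' S d" "\<And>x. x \<in> topspace X \<Longrightarrow> d (f' x) = f x"
    using topological_group_transfer[OF assms(2,3)] by metis
  obtain h where h: "h \<in> hom G H'" "continuous_map T S' h" "\<forall>x\<in>topspace X. h (\<eta> x) = f' x"
    using assms(1) *(1,2) unfolding free_topological_group_def by blast
  show ?thesis
    using h * continuous_map_compose[OF h(2) *(4)] hom_compose[OF h(1) *(3)]
    by (intro bexI[of _ "d \<circ> h"]) auto
qed

lemma free_abelian_topological_group_extend:
  fixes H :: "('h, 'k) monoid_scheme"
  assumes "free_abelian_topological_group X G T \<eta>" "topological_group H S" "comm_group H"
    "continuous_map X S f"
  shows "\<exists>h \<in> hom G H. continuous_map T S h \<and> (\<forall>x\<in>topspace X. h (\<eta> x) = f x)"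
proof -
  obtain H' :: "(bool \<times> 'a) list set monoid" and S' f' d where
    *: "topological_group H' S'" "continuous_map X S' f'"
    "d \<in> hom H' H" "continuous_map S' S d" "\<And>x. x \<in> topspace X \<Longrightarrow> d (f' x) = f x"
    "comm_group H'"
    using topological_group_transfer[OF assms(2,4)] assms(3) by metis
  obtain h where h: "h \<in> hom G H'" "continuous_map T S' h" "\<forall>x\<in>topspace X. h (\<eta> x) = f' x"
    using assms(1) *(1,2,6) unfolding free_abelian_topological_group_def by blast
  show ?thesis
    using h * continuous_map_compose[OF h(2) *(4)] hom_compose[OF h(1) *(3)]
    by (intro bexI[of _ "d \<circ> h"]) auto
qed

end

theory Submission
  imports Defs "HOL-Probability.Discrete_Topology"
begin

text \<open>The covering property is a form of total boundedness that asks for one finite set per index and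
  only for eventual membership: given entourages \<open>E\<^sub>n\<close>, there must be finite
  sets \<open>F\<^sub>n\<close> such that each point lies in \<open>E\<^sub>n[F\<^sub>n]\<close> for almost
  all \<open>n\<close> (\<open>Ufin_O_Gamma_iff_Hurewicz_bounded\<close>). In this form it passes to
  uniformly continuous images, to uniform subspaces and to countable unions, and, because two
  conditions that hold for almost all \<open>n\<close> hold jointly for almost all \<open>n\<close>, to
  finite products. This gives the equivalence of a group with its finite powers.

  The remaining equivalences follow from the cycle \<open>F(X)\<close>, \<open>A(X)\<close>, \<open>X\<close>,
  \<open>F(X)\<close>. The group \<open>A(X)\<close> is a continuous homomorphic image of
  \<open>F(X)\<close>, and such homomorphisms are uniformly continuous.

  From \<open>A(X)\<close> to \<open>X\<close>, the point is that the right uniformity of \<open>A(X)\<close>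
  induces on \<open>X\<close> all of the universal uniformity. An entourage of \<open>X\<close> contains
  all pairs of points at distance less than \<open>1/2\<close> for a suitable bounded distance \<open>d\<close>
  (\<open>entourage_distance\<close>), and \<open>x \<mapsto> d(x, -)\<close> is a continuous map from
  \<open>X\<close> to the Banach space of bounded functions. By the universal property this map
  extends to \<open>A(X)\<close>, so the preimage of a ball is a neighbourhood of the identity that
  induces a subset of the given entourage.

  From \<open>X\<close> to \<open>F(X)\<close>, every continuous map from \<open>X\<close> to a uniform space is
  uniformly continuous for the universal uniformity. Applied to the inclusion and to its composition
  with the inverse, this makes \<open>X\<close> and \<open>X\<^sup>-\<^sup>1\<close> bounded in
  \<open>F(X)\<close>. Products of bounded sets in a group are bounded
  (\<open>Hurewicz_bounded_set_mult\<close>), so the words of any given length form a bounded set, and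
  \<open>F(X)\<close> is the union of countably many of these.\<close>

section \<open>Hurewicz boundedness\<close>

text \<open>The centres \<open>F n\<close> may lie anywhere in the ambient space \<open>Z\<close>. Subsets of
  bounded sets are then bounded with the same centres, and a bounded subset of a group can be covered
  by balls around products of centres.\<close>

definition Hurewicz_bounded :: "'a set \<Rightarrow> ('a \<times> 'a) set set \<Rightarrow> 'a set \<Rightarrow> bool" where
  "Hurewicz_bounded Z \<U> B \<longleftrightarrow>
     (\<forall>E :: nat \<Rightarrow> ('a \<times> 'a) set. (\<forall>n. E n \<in> \<U>) \<longrightarrow>
        (\<exists>F. (\<forall>n. finite (F n) \<and> F n \<subseteq> Z) \<and>
             (\<forall>b\<in>B. \<forall>\<^sub>F n in sequentially. b \<in> E n `` F n)))"

lemma Hurewicz_boundedD: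
  assumes "Hurewicz_bounded Z \<U> B" "\<And>n::nat. E n \<in> \<U>"
  shows "\<exists>F. (\<forall>n. finite (F n) \<and> F n \<subseteq> Z) \<and>
             (\<forall>b\<in>B. \<forall>\<^sub>F n in sequentially. b \<in> E n `` F n)"
  using assms(1)[unfolded Hurewicz_bounded_def, rule_format, OF assms(2)] .

lemma Hurewicz_bounded_mono:
  assumes "Hurewicz_bounded Z \<U> B" "A \<subseteq> B"
  shows "Hurewicz_bounded Z \<U> A"
  using assms(1) unfolding Hurewicz_bounded_def
  by (elim all_forward imp_forward ex_forward conj_forward) (use assms(2) in auto)

text \<open>The set \<open>W\<close> is the interior of \<open>E[z]\<close>. The last conclusion bounds it from
  below uniformly in \<open>z\<close>, so that these interiors form an open uniform cover.\<close>

lemma uniform_interior: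
  assumes "is_uniformity Z \<U>" "E \<in> \<U>" "z \<in> Z"
  defines "W \<equiv> {y \<in> Z. \<exists>D\<in>\<U>. D `` {y} \<subseteq> E `` {z}}"
  shows "openin (uniform_topology Z \<U>) W" "z \<in> W" "W \<subseteq> E `` {z}"
    "\<And>D. D \<in> \<U> \<Longrightarrow> D O D \<subseteq> E \<Longrightarrow> D `` {z} \<subseteq> W"
proof -
  show "openin (uniform_topology Z \<U>) W"
    unfolding openin_uniform_topology[OF assms(1)]
  proof (intro conjI ballI)
    show "W \<subseteq> Z" by (auto simp: W_def)
    fix y assume "y \<in> W"
    then obtain D where D: "D \<in> \<U>" "D `` {y} \<subseteq> E `` {z}" by (auto simp: W_def)
    obtain D' where D': "D' \<in> \<U>" "D' O D' \<subseteq> D"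
      using is_uniformity_half[OF assms(1) D(1)] by blast
    have "D' \<subseteq> Z \<times> Z" using assms(1) D'(1) by (rule is_uniformity_subset)
    then have "D' `` {y} \<subseteq> W" using D D' unfolding W_def by blast
    then show "\<exists>E\<in>\<U>. E `` {y} \<subseteq> W" using D'(1) by blast
  qed
  show "z \<in> W" using assms(2,3) by (auto simp: W_def)
  show "W \<subseteq> E `` {z}"
  proof
    fix y assume "y \<in> W"
    then obtain D where "y \<in> Z" "D \<in> \<U>" "D `` {y} \<subseteq> E `` {z}" by (auto simp: W_def)
    then show "y \<in> E `` {z}" using is_uniformity_refl[OF assms(1)] by blast
  qed
  fix D assume "D \<in> \<U>" "D O D \<subseteq> E"
  then show "D `` {z} \<subseteq> W"
    using is_uniformity_subset[OF assms(1), of D] unfolding W_def by blast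
qed

text \<open>A finite subfamily of the cover by interiors of the sets \<open>E n `` {z}\<close> amounts to a finite
  set of centres; conversely each centre selects a member of the cover around its ball.\<close>

lemma Ufin_O_Gamma_iff_Hurewicz_bounded:
  assumes "is_uniformity Z \<U>"
  shows "Ufin_O_Gamma Z \<U> \<longleftrightarrow> Hurewicz_bounded Z \<U> Z"
proof
  assume *: "Ufin_O_Gamma Z \<U>"
  show "Hurewicz_bounded Z \<U> Z"
    unfolding Hurewicz_bounded_def
  proof (intro allI impI)
    fix E :: "nat \<Rightarrow> ('a \<times> 'a) set" assume E: "\<forall>n. E n \<in> \<U>"
    define W where "W n z = {y \<in> Z. \<exists>D\<in>\<U>. D `` {y} \<subseteq> E n `` {z}}" for n z
    note W = uniform_interior[OF assms E[rule_format], folded W_def]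
    have "open_uniform_cover Z \<U> (W n ` Z)" for n
      unfolding open_uniform_cover_def
    proof (intro conjI)
      show "\<Union>(W n ` Z) = Z" using W(2) by (auto simp: W_def)
      obtain D where D: "D \<in> \<U>" "D O D \<subseteq> E n" using is_uniformity_half[OF assms] E by blast
      then show "\<exists>D\<in>\<U>. \<forall>z\<in>Z. \<exists>A\<in>W n ` Z. D `` {z} \<subseteq> A"
        using W(4)[OF _ D] D(1) by (intro bexI[of _ D] ballI) auto
      show "\<forall>A\<in>W n ` Z. openin (uniform_topology Z \<U>) A" using W(1) by auto
    qed
    then obtain v where v: "\<And>n. finite (v n)" "\<And>n. v n \<subseteq> W n ` Z"
      "\<And>z. z \<in> Z \<Longrightarrow> finite {n. z \<notin> \<Union>(v n)}"
      using *[unfolded Ufin_O_Gamma_def, THEN spec[of _ "\<lambda>n. W n ` Z"]] by metis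
    have "\<forall>n. \<exists>F. finite F \<and> F \<subseteq> Z \<and> v n = W n ` F"
      using finite_subset_image[OF v(1) v(2)] by metis
    then obtain F where F: "\<And>n. finite (F n)" "\<And>n. F n \<subseteq> Z" "\<And>n. v n = W n ` F n" by metis
    have "\<forall>\<^sub>F n in sequentially. z \<in> E n `` F n" if z: "z \<in> Z" for z
    proof -
      have "\<forall>\<^sub>F n in sequentially. z \<in> \<Union>(v n)"
        using v(3)[OF z] by (simp add: eventually_cofinite flip: cofinite_eq_sequentially)
      then show ?thesis
      proof eventually_elim
        case (elim n)
        then obtain x where "x \<in> F n" "z \<in> W n x" using F(3) by auto
        moreover have "W n x \<subseteq> E n `` {x}" using \<open>x \<in> F n\<close> F(2) by (intro W(3)) auto
        ultimately show ?case by blast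
      qed
    qed
    then show "\<exists>F. (\<forall>n. finite (F n) \<and> F n \<subseteq> Z) \<and>
        (\<forall>b\<in>Z. \<forall>\<^sub>F n in sequentially. b \<in> E n `` F n)"
      using F(1,2) by (intro exI[of _ F]) simp
  qed
next
  assume *: "Hurewicz_bounded Z \<U> Z"
  show "Ufin_O_Gamma Z \<U>"
    unfolding Ufin_O_Gamma_def
  proof (intro allI impI)
    fix u :: "nat \<Rightarrow> 'a set set" assume "\<forall>n. open_uniform_cover Z \<U> (u n)"
    then have "\<forall>n. \<exists>E\<in>\<U>. \<forall>z\<in>Z. \<exists>A\<in>u n. E `` {z} \<subseteq> A"
      unfolding open_uniform_cover_def by (elim all_forward conjE)
    then obtain E where E: "\<And>n. E n \<in> \<U>" "\<And>n. \<forall>z\<in>Z. \<exists>A\<in>u n. E n `` {z} \<subseteq> A"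
      by metis
    then have "\<forall>n z. \<exists>A. z \<in> Z \<longrightarrow> A \<in> u n \<and> E n `` {z} \<subseteq> A" by blast
    then obtain A where A: "\<And>n z. z \<in> Z \<Longrightarrow> A n z \<in> u n \<and> E n `` {z} \<subseteq> A n z" by metis
    obtain F where F: "\<forall>n. finite (F n) \<and> F n \<subseteq> Z"
      "\<forall>b\<in>Z. \<forall>\<^sub>F n in sequentially. b \<in> E n `` F n"
      using Hurewicz_boundedD[where E = E, OF * E(1)] by (elim exE conjE)
    have "finite {n. z \<notin> \<Union>(A n ` F n)}" if z: "z \<in> Z" for z
    proof -
      have "\<forall>\<^sub>F n in sequentially. z \<in> \<Union>(A n ` F n)"
        using F(2)[rule_format, OF z]
      proof eventually_elim
        case (elim n)
        then obtain x where "x \<in> F n" "z \<in> E n `` {x}" by blast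
        moreover have "E n `` {x} \<subseteq> A n x" using \<open>x \<in> F n\<close> F(1) A by blast
        ultimately show ?case by blast
      qed
      then show ?thesis by (simp add: eventually_cofinite flip: cofinite_eq_sequentially)
    qed
    moreover have "finite (A n ` F n) \<and> A n ` F n \<subseteq> u n" for n using A F(1) by blast
    ultimately show "\<exists>v. (\<forall>n. finite (v n) \<and> v n \<subseteq> u n) \<and> (\<forall>z\<in>Z. finite {n. z \<notin> \<Union>(v n)})"
      by (intro exI[of _ "\<lambda>n. A n ` F n"]) simp
  qed
qed

lemma Hurewicz_bounded_image:
  assumes "Hurewicz_bounded Z \<U> B" and "B \<subseteq> Z" and "f ` Z \<subseteq> Y"
    and unif: "\<And>E. E \<in> \<V> \<Longrightarrow> {(x, y) \<in> Z \<times> Z. (f x, f y) \<in> E} \<in> \<U>"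
  shows "Hurewicz_bounded Y \<V> (f ` B)"
  unfolding Hurewicz_bounded_def
proof (intro allI impI)
  fix E assume E: "\<forall>n::nat. E n \<in> \<V>"
  then have "\<exists>F. (\<forall>n. finite (F n) \<and> F n \<subseteq> Z) \<and>
      (\<forall>b\<in>B. \<forall>\<^sub>F n in sequentially. b \<in> {(x, y) \<in> Z \<times> Z. (f x, f y) \<in> E n} `` F n)"
    by (intro Hurewicz_boundedD[OF assms(1)] unif) simp
  then obtain F where F: "\<forall>n. finite (F n) \<and> F n \<subseteq> Z"
    "\<forall>b\<in>B. \<forall>\<^sub>F n in sequentially. b \<in> {(x, y) \<in> Z \<times> Z. (f x, f y) \<in> E n} `` F n"
    by (elim exE conjE)
  have "\<forall>\<^sub>F n in sequentially. f b \<in> E n `` (f ` F n)" if "b \<in> B" for b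
    using F(2)[rule_format, OF that] by eventually_elim auto
  moreover have "finite (f ` F n) \<and> f ` F n \<subseteq> Y" for n using F(1) assms(3) by blast
  ultimately show "\<exists>F. (\<forall>n. finite (F n) \<and> F n \<subseteq> Y) \<and>
      (\<forall>b\<in>f ` B. \<forall>\<^sub>F n in sequentially. b \<in> E n `` F n)"
    by (intro exI[of _ "\<lambda>n. f ` F n"]) blast
qed

text \<open>The hypothesis says that \<open>\<U>\<close> is no finer than the uniformity pulled back along
  \<open>f\<close>. For an inclusion this is the heredity of boundedness in subspaces.\<close>

lemma Hurewicz_bounded_vimage:
  assumes bdd: "Hurewicz_bounded Y \<V> (f ` Z)" and "is_uniformity Y \<V>"
    and emb: "\<And>E. E \<in> \<U> \<Longrightarrow> \<exists>D\<in>\<V>. \<forall>x\<in>Z. \<forall>y\<in>Z. (f x, f y) \<in> D \<longrightarrow> (x, y) \<in> E"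
  shows "Hurewicz_bounded Z \<U> Z"
  unfolding Hurewicz_bounded_def
proof (intro allI impI)
  fix E assume E: "\<forall>n::nat. E n \<in> \<U>"
  have "\<exists>D\<in>\<V>. \<forall>p q y. (p, q) \<in> D \<and> (p, f y) \<in> D \<and> y \<in> Z \<longrightarrow>
           (\<forall>x\<in>Z. f x = q \<longrightarrow> (x, y) \<in> E n)" for n
  proof -
    obtain C where C: "C \<in> \<V>" "\<forall>x\<in>Z. \<forall>y\<in>Z. (f x, f y) \<in> C \<longrightarrow> (x, y) \<in> E n"
      using emb E by blast
    obtain D where D: "D \<in> \<V>" "D O D \<subseteq> C" using is_uniformity_half[OF assms(2) C(1)] by blast
    have "D \<inter> D\<inverse> \<in> \<V>"
      using D(1) is_uniformity_Int[OF assms(2)] is_uniformity_converse[OF assms(2)] by blast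
    then show ?thesis using C(2) D(2) by (intro bexI[of _ "D \<inter> D\<inverse>"]) blast+
  qed
  then obtain D where D: "\<And>n. D n \<in> \<V>"
    "\<And>n p x y. (p, f x) \<in> D n \<Longrightarrow> (p, f y) \<in> D n \<Longrightarrow> x \<in> Z \<Longrightarrow> y \<in> Z \<Longrightarrow> (x, y) \<in> E n"
    by metis
  obtain F where F: "\<forall>n. finite (F n) \<and> F n \<subseteq> Y"
    "\<forall>b\<in>f ` Z. \<forall>\<^sub>F n in sequentially. b \<in> D n `` F n"
    using Hurewicz_boundedD[where E = D, OF bdd D(1)] by (elim exE conjE)
  \<comment> \<open>The centres found in \<open>Y\<close> need not lie in the image, so each one that is close to some
    \<open>f x\<close> is replaced by such an \<open>x\<close>.\<close>
  define s where "s n p = (SOME x. x \<in> Z \<and> (p, f x) \<in> D n)" for n p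
  have s: "s n p \<in> Z \<and> (p, f (s n p)) \<in> D n" if "x \<in> Z" "(p, f x) \<in> D n" for n p x
    unfolding s_def by (rule someI[of _ x]) (use that in blast)
  define F' where "F' n = s n ` F n \<inter> Z" for n
  have "\<forall>\<^sub>F n in sequentially. z \<in> E n `` F' n" if z: "z \<in> Z" for z
  proof -
    have "\<forall>\<^sub>F n in sequentially. f z \<in> D n `` F n" using F(2) z by blast
    then show ?thesis
    proof eventually_elim
      case (elim n)
      then obtain p where p: "p \<in> F n" "(p, f z) \<in> D n" by blast
      then have "s n p \<in> F' n" "(s n p, z) \<in> E n"
        using s[OF z p(2)] D(2) z by (auto simp: F'_def)
      then show ?case by blast
    qed
  qed
  moreover have "finite (F' n) \<and> F' n \<subseteq> Z" for n using F(1) by (auto simp: F'_def)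
  ultimately show "\<exists>F. (\<forall>n. finite (F n) \<and> F n \<subseteq> Z) \<and>
      (\<forall>b\<in>Z. \<forall>\<^sub>F n in sequentially. b \<in> E n `` F n)" by blast
qed

text \<open>At index \<open>n\<close> the centres for the sets of index at most \<open>n\<close> suffice, since each point only
  has to be covered eventually.\<close>

lemma Hurewicz_bounded_UN:
  fixes B :: "nat \<Rightarrow> 'a set"
  assumes "\<And>k. Hurewicz_bounded Z \<U> (B k)"
  shows "Hurewicz_bounded Z \<U> (\<Union>k. B k)"
  unfolding Hurewicz_bounded_def
proof (intro allI impI)
  fix E assume "\<forall>n::nat. E n \<in> \<U>"
  then have "\<forall>k. \<exists>F. (\<forall>n. finite (F n) \<and> F n \<subseteq> Z) \<and>
      (\<forall>b\<in>B k. \<forall>\<^sub>F n in sequentially. b \<in> E n `` F n)"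
    using assms unfolding Hurewicz_bounded_def by blast
  then obtain F where F: "\<And>k n. finite (F k n) \<and> F k n \<subseteq> Z"
    "\<And>k b. b \<in> B k \<Longrightarrow> \<forall>\<^sub>F n in sequentially. b \<in> E n `` F k n" by metis
  have "\<forall>\<^sub>F n in sequentially. b \<in> E n `` (\<Union>k\<le>n. F k n)" if "b \<in> B k" for b k
    using F(2)[OF that] eventually_ge_at_top[of k] by eventually_elim blast
  moreover have "finite (\<Union>k\<le>n. F k n) \<and> (\<Union>k\<le>n. F k n) \<subseteq> Z" for n using F(1) by auto
  ultimately show "\<exists>F. (\<forall>n. finite (F n) \<and> F n \<subseteq> Z) \<and>
      (\<forall>b\<in>\<Union>k. B k. \<forall>\<^sub>F n in sequentially. b \<in> E n `` F n)"
    by (intro exI[of _ "\<lambda>n. \<Union>k\<le>n. F k n"]) blast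
qed

lemma Hurewicz_bounded_Un:
  assumes "Hurewicz_bounded Z \<U> A" "Hurewicz_bounded Z \<U> B"
  shows "Hurewicz_bounded Z \<U> (A \<union> B)"
proof -
  have "(\<Union>k::nat. if k = 0 then A else B) = A \<union> B"
    by (auto split: if_splits intro: exI[of _ 0] exI[of _ 1])
  then show ?thesis
    using Hurewicz_bounded_UN[of Z \<U> "\<lambda>k. if k = 0 then A else B"] assms by simp
qed

lemma Hurewicz_bounded_finite:
  assumes "is_uniformity Z \<U>" "finite B" "B \<subseteq> Z"
  shows "Hurewicz_bounded Z \<U> B"
  unfolding Hurewicz_bounded_def
proof (intro allI impI exI[of _ "\<lambda>_. B"] conjI ballI always_eventually)
  fix E n b assume "\<forall>n::nat. E n \<in> \<U>" "b \<in> B"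
  then show "b \<in> E n `` B" using is_uniformity_refl[OF assms(1), of "E n"] assms(3) by blast
qed (use assms in auto)


section \<open>Hurewicz bounded sets in topological groups\<close>

definition right_entourage :: "('a, 'm) monoid_scheme \<Rightarrow> 'a set \<Rightarrow> ('a \<times> 'a) set" where
  "right_entourage G U = {(x, y) \<in> carrier G \<times> carrier G. x \<otimes>\<^bsub>G\<^esub> inv\<^bsub>G\<^esub> y \<in> U}"

lemma right_entourage_mono: "U \<subseteq> V \<Longrightarrow> right_entourage G U \<subseteq> right_entourage G V"
  unfolding right_entourage_def by auto

lemma right_uniformity_iff:
  "E \<in> right_uniformity G T \<longleftrightarrow> E \<subseteq> carrier G \<times> carrier G \<and>
     (\<exists>U. openin T U \<and> \<one>\<^bsub>G\<^esub> \<in> U \<and> right_entourage G U \<subseteq> E)"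
  unfolding right_uniformity_def right_entourage_def by (rule mem_Collect_eq)

lemma right_entourage_in_uniformity:
  assumes "openin T U" "\<one>\<^bsub>G\<^esub> \<in> U"
  shows "right_entourage G U \<in> right_uniformity G T"
  unfolding right_uniformity_iff
proof (intro conjI exI[of _ U] assms order_refl)
  show "right_entourage G U \<subseteq> carrier G \<times> carrier G" by (auto simp: right_entourage_def)
qed

lemma is_uniformity_right_uniformity:
  assumes "topological_group G T"
  shows "is_uniformity (carrier G) (right_uniformity G T)"
  using compatible_right_uniformity[OF assms] assms
  by (simp add: compatible_uniformity_def topological_group_def)

lemma group_Ufin_O_Gamma_iff:
  assumes "topological_group G T"
  shows "group_Ufin_O_Gamma G T \<longleftrightarrow>
    Hurewicz_bounded (carrier G) (right_uniformity G T) (carrier G)"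
  by (rule Ufin_O_Gamma_iff_Hurewicz_bounded[OF is_uniformity_right_uniformity[OF assms]])

lemma continuous_map_group_mult:
  assumes "topological_group G T" "continuous_map Y T f" "continuous_map Y T g"
  shows "continuous_map Y T (\<lambda>x. f x \<otimes>\<^bsub>G\<^esub> g x)"
proof -
  have m: "continuous_map (prod_topology T T) T (\<lambda>(x, y). x \<otimes>\<^bsub>G\<^esub> y)"
    using assms(1) unfolding topological_group_def by blast
  have "continuous_map Y (prod_topology T T) (\<lambda>x. (f x, g x))"
    using assms(2,3) by (simp add: continuous_map_pairedI)
  from continuous_map_compose[OF this m] show ?thesis by (simp add: o_def)
qed

lemma group_square_neighbourhood:
  assumes "topological_group G T" "openin T U" "\<one>\<^bsub>G\<^esub> \<in> U"
  shows "\<exists>V. openin T V \<and> \<one>\<^bsub>G\<^esub> \<in> V \<and> V <#>\<^bsub>G\<^esub> V \<subseteq> U"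
proof -
  interpret group G using assms(1) by (simp add: topological_group_def)
  have top: "topspace T = carrier G" using assms(1) by (simp add: topological_group_def)
  define P where "P = {p \<in> topspace (prod_topology T T). (\<lambda>(x, y). x \<otimes>\<^bsub>G\<^esub> y) p \<in> U}"
  have "openin (prod_topology T T) P"
    using assms unfolding topological_group_def P_def
    by (intro openin_continuous_map_preimage) auto
  moreover have "(\<one>\<^bsub>G\<^esub>, \<one>\<^bsub>G\<^esub>) \<in> P" using top assms(3) by (simp add: P_def)
  ultimately obtain V W where VW: "openin T V" "openin T W" "\<one>\<^bsub>G\<^esub> \<in> V" "\<one>\<^bsub>G\<^esub> \<in> W" "V \<times> W \<subseteq> P"
    unfolding openin_prod_topology_alt by meson
  have "(V \<inter> W) <#>\<^bsub>G\<^esub> (V \<inter> W) \<subseteq> U" using VW(5) by (auto simp: set_mult_def P_def)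
  then show ?thesis using VW by (intro exI[of _ "V \<inter> W"]) auto
qed

lemma openin_Collect_finite_Ball:
  assumes "finite F" "\<And>f. f \<in> F \<Longrightarrow> openin T {x \<in> topspace T. P f x}"
  shows "openin T {x \<in> topspace T. \<forall>f\<in>F. P f x}"
  using assms
proof (induction F)
  case (insert f F)
  have "{x \<in> topspace T. \<forall>g\<in>insert f F. P g x} =
      {x \<in> topspace T. P f x} \<inter> {x \<in> topspace T. \<forall>f\<in>F. P f x}" by auto
  then show ?case using insert by (simp add: openin_Int)
qed simp

text \<open>If \<open>a\<close> is close to \<open>f\<close> and \<open>b\<close> is close to \<open>f'\<close>, then
  \<open>ab\<close> is close to \<open>ff'\<close>, because
  \<open>ff'(ab)\<^sup>-\<^sup>1\<close> is the conjugate of \<open>f'b\<^sup>-\<^sup>1\<close> by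
  \<open>f\<close>, times \<open>fa\<^sup>-\<^sup>1\<close>. How close \<open>b\<close> has to be depends on
  \<open>f\<close>, which is harmless since only finitely many \<open>f\<close> occur at each index.\<close>

lemma Hurewicz_bounded_set_mult:
  assumes tg: "topological_group G T"
    and "A \<subseteq> carrier G" "Hurewicz_bounded (carrier G) (right_uniformity G T) A"
    and "B \<subseteq> carrier G" "Hurewicz_bounded (carrier G) (right_uniformity G T) B"
  shows "Hurewicz_bounded (carrier G) (right_uniformity G T) (A <#>\<^bsub>G\<^esub> B)"
  unfolding Hurewicz_bounded_def
proof (intro allI impI)
  interpret group G using tg by (simp add: topological_group_def)
  have top: "topspace T = carrier G" using tg by (simp add: topological_group_def)
  fix E assume E: "\<forall>n::nat. E n \<in> right_uniformity G T"
  have "\<exists>V. openin T V \<and> \<one>\<^bsub>G\<^esub> \<in> V \<and> right_entourage G (V <#>\<^bsub>G\<^esub> V) \<subseteq> E n" for n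
  proof -
    obtain U where U: "openin T U" "\<one>\<^bsub>G\<^esub> \<in> U" "right_entourage G U \<subseteq> E n"
      using E unfolding right_uniformity_iff by blast
    obtain V where V: "openin T V" "\<one>\<^bsub>G\<^esub> \<in> V" "V <#>\<^bsub>G\<^esub> V \<subseteq> U"
      using group_square_neighbourhood[OF tg U(1,2)] by blast
    have "right_entourage G (V <#>\<^bsub>G\<^esub> V) \<subseteq> right_entourage G U"
      by (rule right_entourage_mono[OF V(3)])
    then show ?thesis using U V by blast
  qed
  then obtain V where V: "\<And>n. openin T (V n)" "\<And>n. \<one>\<^bsub>G\<^esub> \<in> V n"
    "\<And>n. right_entourage G (V n <#>\<^bsub>G\<^esub> V n) \<subseteq> E n" by metis
  obtain F where F: "\<forall>n. finite (F n) \<and> F n \<subseteq> carrier G"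
    "\<forall>a\<in>A. \<forall>\<^sub>F n in sequentially. a \<in> right_entourage G (V n) `` F n"
    using Hurewicz_boundedD[OF assms(3), where E = "\<lambda>n. right_entourage G (V n)"]
      right_entourage_in_uniformity[OF V(1,2)] by auto
  \<comment> \<open>The centres for \<open>A\<close> are fixed before the neighbourhoods used for \<open>B\<close>: these must stay
    inside \<open>V n\<close> under conjugation by the finitely many centres.\<close>
  define W where "W n = {x \<in> topspace T. \<forall>f\<in>F n. f \<otimes>\<^bsub>G\<^esub> x \<otimes>\<^bsub>G\<^esub> inv\<^bsub>G\<^esub> f \<in> V n}" for n
  have W: "openin T (W n)" "\<one>\<^bsub>G\<^esub> \<in> W n" for n
  proof -
    show "openin T (W n)"
      unfolding W_def
    proof (rule openin_Collect_finite_Ball)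
      fix f assume "f \<in> F n"
      then have "f \<in> topspace T" using F(1) top by blast
      then have "continuous_map T T (\<lambda>x. f \<otimes>\<^bsub>G\<^esub> x \<otimes>\<^bsub>G\<^esub> inv\<^bsub>G\<^esub> f)"
        by (intro continuous_map_group_div[OF tg] continuous_map_group_mult[OF tg]) auto
      then show "openin T {x \<in> topspace T. f \<otimes>\<^bsub>G\<^esub> x \<otimes>\<^bsub>G\<^esub> inv\<^bsub>G\<^esub> f \<in> V n}"
        by (rule openin_continuous_map_preimage[OF _ V(1)])
    qed (use F in auto)
    have "f \<otimes>\<^bsub>G\<^esub> \<one>\<^bsub>G\<^esub> \<otimes>\<^bsub>G\<^esub> inv\<^bsub>G\<^esub> f \<in> V n" if "f \<in> F n" for f
    proof -
      have "f \<in> carrier G" using F(1) that by blast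
      then show ?thesis using V(2) by simp
    qed
    then show "\<one>\<^bsub>G\<^esub> \<in> W n" unfolding W_def top by simp
  qed
  obtain F' where F': "\<forall>n. finite (F' n) \<and> F' n \<subseteq> carrier G"
    "\<forall>b\<in>B. \<forall>\<^sub>F n in sequentially. b \<in> right_entourage G (W n) `` F' n"
    using Hurewicz_boundedD[OF assms(5), where E = "\<lambda>n. right_entourage G (W n)"]
      right_entourage_in_uniformity[OF W(1,2)] by auto
  have "\<forall>\<^sub>F n in sequentially. a \<otimes>\<^bsub>G\<^esub> b \<in> E n `` (F n <#>\<^bsub>G\<^esub> F' n)" if "a \<in> A" "b \<in> B" for a b
    using F(2)[rule_format, OF that(1)] F'(2)[rule_format, OF that(2)]
  proof eventually_elim
    case (elim n)
    then obtain f f' where f: "f \<in> F n" "(f, a) \<in> right_entourage G (V n)"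
      "f' \<in> F' n" "(f', b) \<in> right_entourage G (W n)" by blast
    then have c: "f \<in> carrier G" "a \<in> carrier G" "f' \<in> carrier G" "b \<in> carrier G"
      and v: "f \<otimes>\<^bsub>G\<^esub> inv\<^bsub>G\<^esub> a \<in> V n" "f \<otimes>\<^bsub>G\<^esub> (f' \<otimes>\<^bsub>G\<^esub> inv\<^bsub>G\<^esub> b) \<otimes>\<^bsub>G\<^esub> inv\<^bsub>G\<^esub> f \<in> V n"
      by (auto simp: right_entourage_def W_def)
    have "inv\<^bsub>G\<^esub> f \<otimes>\<^bsub>G\<^esub> (f \<otimes>\<^bsub>G\<^esub> inv\<^bsub>G\<^esub> a) = inv\<^bsub>G\<^esub> a"
      using c by (simp flip: m_assoc)
    then have "(f \<otimes>\<^bsub>G\<^esub> f') \<otimes>\<^bsub>G\<^esub> inv\<^bsub>G\<^esub> (a \<otimes>\<^bsub>G\<^esub> b) =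
        (f \<otimes>\<^bsub>G\<^esub> (f' \<otimes>\<^bsub>G\<^esub> inv\<^bsub>G\<^esub> b) \<otimes>\<^bsub>G\<^esub> inv\<^bsub>G\<^esub> f) \<otimes>\<^bsub>G\<^esub> (f \<otimes>\<^bsub>G\<^esub> inv\<^bsub>G\<^esub> a)"
      using c by (simp add: inv_mult_group m_assoc)
    then have "(f \<otimes>\<^bsub>G\<^esub> f') \<otimes>\<^bsub>G\<^esub> inv\<^bsub>G\<^esub> (a \<otimes>\<^bsub>G\<^esub> b) \<in> V n <#>\<^bsub>G\<^esub> V n"
      using v unfolding set_mult_def by blast
    then have "(f \<otimes>\<^bsub>G\<^esub> f', a \<otimes>\<^bsub>G\<^esub> b) \<in> right_entourage G (V n <#>\<^bsub>G\<^esub> V n)"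
      using c by (simp add: right_entourage_def)
    moreover have "f \<otimes>\<^bsub>G\<^esub> f' \<in> F n <#>\<^bsub>G\<^esub> F' n" using f(1,3) unfolding set_mult_def by blast
    ultimately show ?case using V(3) by blast
  qed
  moreover have "finite (F n <#>\<^bsub>G\<^esub> F' n) \<and> F n <#>\<^bsub>G\<^esub> F' n \<subseteq> carrier G" for n
    using F(1) F'(1) set_mult_closed[of "F n" "F' n"] by (auto simp: set_mult_def)
  ultimately show "\<exists>F. (\<forall>n. finite (F n) \<and> F n \<subseteq> carrier G) \<and>
      (\<forall>c\<in>A <#>\<^bsub>G\<^esub> B. \<forall>\<^sub>F n in sequentially. c \<in> E n `` F n)"
    by (intro exI[of _ "\<lambda>n. F n <#>\<^bsub>G\<^esub> F' n"]) (auto simp: set_mult_def)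
qed

text \<open>The generated subgroup is exhausted by the sets obtained from
  \<open>S \<union> S\<^sup>-\<^sup>1 \<union> {1}\<close> by repeated squaring. Squaring instead of
  appending single letters makes closure under products immediate, because the sets increase.\<close>

lemma Hurewicz_bounded_generate:
  assumes tg: "topological_group G T" and S: "S \<subseteq> carrier G"
    and "Hurewicz_bounded (carrier G) (right_uniformity G T) S"
    and "Hurewicz_bounded (carrier G) (right_uniformity G T) (m_inv G ` S)"
  shows "Hurewicz_bounded (carrier G) (right_uniformity G T) (generate G S)"
proof -
  interpret group G using tg by (simp add: topological_group_def)
  define Y where "Y = rec_nat (insert \<one>\<^bsub>G\<^esub> (S \<union> m_inv G ` S)) (\<lambda>_ Y. Y <#>\<^bsub>G\<^esub> Y)"
  have Y0: "Y 0 = insert \<one>\<^bsub>G\<^esub> (S \<union> m_inv G ` S)" and YS: "Y (Suc k) = Y k <#>\<^bsub>G\<^esub> Y k" for k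
    by (simp_all add: Y_def)
  have Yc: "Y k \<subseteq> carrier G" for k
    by (induction k) (use S set_mult_closed in \<open>auto simp: Y0 YS\<close>)
  have Y1: "\<one>\<^bsub>G\<^esub> \<in> Y k" for k
  proof (induction k)
    case (Suc k)
    then have "\<one>\<^bsub>G\<^esub> \<otimes>\<^bsub>G\<^esub> \<one>\<^bsub>G\<^esub> \<in> Y (Suc k)" unfolding YS set_mult_def by blast
    then show ?case by simp
  qed (simp add: Y0)
  have "Y k \<subseteq> Y (Suc k)" for k
  proof
    fix y assume y: "y \<in> Y k"
    then have "y \<in> carrier G" using Yc by blast
    then have "y = y \<otimes>\<^bsub>G\<^esub> \<one>\<^bsub>G\<^esub>" by simp
    then show "y \<in> Y (Suc k)" using y Y1 unfolding YS set_mult_def by blast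
  qed
  then have mono: "Y i \<subseteq> Y j" if "i \<le> j" for i j by (rule lift_Suc_mono_le[OF _ that])
  have bdd: "Hurewicz_bounded (carrier G) (right_uniformity G T) (Y k)" for k
  proof (induction k)
    case 0
    have "Hurewicz_bounded (carrier G) (right_uniformity G T) ({\<one>\<^bsub>G\<^esub>} \<union> (S \<union> m_inv G ` S))"
      using Hurewicz_bounded_finite[OF is_uniformity_right_uniformity[OF tg], of "{\<one>\<^bsub>G\<^esub>}"]
      by (intro Hurewicz_bounded_Un assms(3,4)) auto
    then show ?case by (simp add: Y0)
  next
    case (Suc k)
    show ?case unfolding YS by (rule Hurewicz_bounded_set_mult[OF tg Yc Suc.IH Yc Suc.IH])
  qed
  have "\<exists>k. y \<in> Y k" if "y \<in> generate G S" for y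
    using that
  proof induction
    case one
    show ?case by (rule exI[of _ 0]) (simp add: Y0)
  next
    case (incl h)
    then show ?case by (intro exI[of _ 0]) (simp add: Y0)
  next
    case (inv h)
    then show ?case by (intro exI[of _ 0]) (simp add: Y0)
  next
    case (eng h1 h2)
    then obtain i j where "h1 \<in> Y i" "h2 \<in> Y j" by blast
    then have "h1 \<in> Y (max i j)" "h2 \<in> Y (max i j)" using mono[of i "max i j"] mono[of j "max i j"] by auto
    then have "h1 \<otimes>\<^bsub>G\<^esub> h2 \<in> Y (Suc (max i j))" unfolding YS set_mult_def by blast
    then show ?case by blast
  qed
  then have "generate G S \<subseteq> (\<Union>k. Y k)" by blast
  with Hurewicz_bounded_UN[of "carrier G" "right_uniformity G T" Y, OF bdd]
  show ?thesis by (rule Hurewicz_bounded_mono)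
qed

lemma continuous_hom_uniformly_continuous:
  assumes G: "topological_group G T" and H: "topological_group H S"
    and h: "h \<in> hom G H" "continuous_map T S h" and E: "E \<in> right_uniformity H S"
  shows "{(x, y) \<in> carrier G \<times> carrier G. (h x, h y) \<in> E} \<in> right_uniformity G T"
proof -
  interpret group_hom G H h
    using G H h(1) by (simp add: topological_group_def group_hom_def group_hom_axioms_def)
  have top: "topspace T = carrier G" using G by (simp add: topological_group_def)
  obtain U where U: "openin S U" "\<one>\<^bsub>H\<^esub> \<in> U" "right_entourage H U \<subseteq> E"
    using E unfolding right_uniformity_iff by blast
  have "right_entourage G {x \<in> topspace T. h x \<in> U} \<subseteq> {(x, y) \<in> carrier G \<times> carrier G. (h x, h y) \<in> E}"
    using U(3) by (auto simp: right_entourage_def)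
  moreover have "openin T {x \<in> topspace T. h x \<in> U}"
    by (rule openin_continuous_map_preimage[OF h(2) U(1)])
  moreover have "\<one>\<^bsub>G\<^esub> \<in> {x \<in> topspace T. h x \<in> U}" using top U(2) by simp
  ultimately show ?thesis unfolding right_uniformity_iff by blast
qed

lemma group_Ufin_O_Gamma_image:
  assumes G: "topological_group G T" and H: "topological_group H S"
    and h: "h \<in> hom G H" "continuous_map T S h" "h ` carrier G = carrier H"
    and "group_Ufin_O_Gamma G T"
  shows "group_Ufin_O_Gamma H S"
proof -
  have "Hurewicz_bounded (carrier H) (right_uniformity H S) (h ` carrier G)"
    using assms(6) h(3) continuous_hom_uniformly_continuous[OF G H h(1,2)]
    unfolding group_Ufin_O_Gamma_iff[OF G]
    by (intro Hurewicz_bounded_image[of "carrier G" "right_uniformity G T"]) auto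
  then show ?thesis unfolding group_Ufin_O_Gamma_iff[OF H] h(3) .
qed

text \<open>A basic neighbourhood of the identity of \<open>G\<^sup>n\<close> contains a cube \<open>W\<^sup>n\<close>,
  and the cube of a finite set of centres for \<open>W\<close> serves as the set of centres. Each of the
  \<open>n\<close> coordinates is covered eventually, hence all of them are.\<close>

lemma group_Ufin_O_Gamma_power:
  assumes tg: "topological_group G T" and bdd: "group_Ufin_O_Gamma G T"
  shows "group_Ufin_O_Gamma (power_group G n) (power_topology T n)"
  unfolding group_Ufin_O_Gamma_iff[OF topological_group_product[OF tg]] Hurewicz_bounded_def
proof (intro allI impI)
  let ?P = "power_group G n"
  interpret group G using tg by (simp add: topological_group_def)
  have top: "topspace T = carrier G" using tg by (simp add: topological_group_def)
  fix E assume E: "\<forall>k::nat. E k \<in> right_uniformity ?P (power_topology T n)"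
  have "\<exists>W. openin T W \<and> \<one>\<^bsub>G\<^esub> \<in> W \<and> right_entourage ?P (PiE {..<n} (\<lambda>_. W)) \<subseteq> E k" for k
  proof -
    obtain U where U: "openin (power_topology T n) U" "\<one>\<^bsub>?P\<^esub> \<in> U" "right_entourage ?P U \<subseteq> E k"
      using E unfolding right_uniformity_iff by blast
    obtain V where V: "\<forall>i\<in>{..<n}. openin T (V i)" "\<one>\<^bsub>?P\<^esub> \<in> PiE {..<n} V" "PiE {..<n} V \<subseteq> U"
      using U(1)[unfolded openin_product_topology_alt, THEN bspec, OF U(2)] by blast
    define W where "W = {x \<in> topspace T. \<forall>i\<in>{..<n}. x \<in> V i}"
    have "openin T W"
      unfolding W_def
    proof (rule openin_Collect_finite_Ball)
      fix i assume "i \<in> {..<n}"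
      then have "openin T (topspace T \<inter> V i)" using V(1) by blast
      then show "openin T {x \<in> topspace T. x \<in> V i}" by (simp add: Int_def)
    qed simp
    moreover have "\<one>\<^bsub>G\<^esub> \<in> W" using V(2) top by (auto simp: W_def PiE_iff)
    moreover have "PiE {..<n} (\<lambda>_. W) \<subseteq> PiE {..<n} V" by (rule PiE_mono) (auto simp: W_def)
    then have "right_entourage ?P (PiE {..<n} (\<lambda>_. W)) \<subseteq> E k"
      using V(3) U(3) by (meson right_entourage_mono subset_trans)
    ultimately show ?thesis by blast
  qed
  then obtain W where W: "\<And>k. openin T (W k)" "\<And>k. \<one>\<^bsub>G\<^esub> \<in> W k"
    "\<And>k. right_entourage ?P (PiE {..<n} (\<lambda>_. W k)) \<subseteq> E k" by metis
  obtain F where F: "\<forall>k. finite (F k) \<and> F k \<subseteq> carrier G"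
    "\<forall>x\<in>carrier G. \<forall>\<^sub>F k in sequentially. x \<in> right_entourage G (W k) `` F k"
    using Hurewicz_boundedD[OF bdd[unfolded group_Ufin_O_Gamma_iff[OF tg]],
        where E = "\<lambda>k. right_entourage G (W k)"]
      right_entourage_in_uniformity[OF W(1,2)] by auto
  have "\<forall>\<^sub>F k in sequentially. z \<in> E k `` (PiE {..<n} (\<lambda>_. F k))" if z: "z \<in> carrier ?P" for z
  proof -
    have zi: "z i \<in> carrier G" if "i < n" for i using z that by auto
    then have "\<forall>\<^sub>F k in sequentially. \<forall>i\<in>{..<n}. z i \<in> right_entourage G (W k) `` F k"
      using F(2) by (intro eventually_ball_finite) auto
    then show ?thesis
    proof eventually_elim
      case (elim k)
      then have "\<forall>i\<in>{..<n}. \<exists>y. y \<in> F k \<and> (y, z i) \<in> right_entourage G (W k)" by blast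
      then obtain y where y: "\<And>i. i < n \<Longrightarrow> y i \<in> F k \<and> (y i, z i) \<in> right_entourage G (W k)"
        by (metis lessThan_iff)
      define y' where "y' = restrict y {..<n}"
      have "y' \<in> PiE {..<n} (\<lambda>_. F k)" using y by (auto simp: y'_def)
      moreover have "(y', z) \<in> right_entourage ?P (PiE {..<n} (\<lambda>_. W k))"
        using y z group_axioms by (auto simp: right_entourage_def y'_def)
      ultimately show ?case using W(3) by blast
    qed
  qed
  moreover have "finite (PiE {..<n} (\<lambda>_. F k)) \<and> PiE {..<n} (\<lambda>_. F k) \<subseteq> carrier ?P" for k
  proof
    show "finite (PiE {..<n} (\<lambda>_. F k))" using F(1) by (intro finite_PiE) auto
    show "PiE {..<n} (\<lambda>_. F k) \<subseteq> carrier ?P"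
      unfolding carrier_product_group by (rule PiE_mono) (use F(1) in blast)
  qed
  ultimately show "\<exists>F. (\<forall>k. finite (F k) \<and> F k \<subseteq> carrier ?P) \<and>
      (\<forall>z\<in>carrier ?P. \<forall>\<^sub>F k in sequentially. z \<in> E k `` F k)"
    by (intro exI[of _ "\<lambda>k. PiE {..<n} (\<lambda>_. F k)"]) simp
qed

lemma group_Ufin_O_Gamma_iff_powers:
  assumes tg: "topological_group G T"
  shows "group_Ufin_O_Gamma G T \<longleftrightarrow>
    (\<forall>n. group_Ufin_O_Gamma (power_group G n) (power_topology T n))"
proof
  show "group_Ufin_O_Gamma G T" if "\<forall>n. group_Ufin_O_Gamma (power_group G n) (power_topology T n)"
  proof (rule group_Ufin_O_Gamma_image[OF topological_group_product[OF tg] tg])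
    show "(\<lambda>x. x 0) \<in> hom (power_group G 1) G" by (auto simp: hom_def)
    show "continuous_map (power_topology T 1) T (\<lambda>x. x 0)"
      by (rule continuous_map_product_projection) simp
    have "x \<in> (\<lambda>x. x 0) ` carrier (power_group G 1)" if "x \<in> carrier G" for x
      by (rule image_eqI[of _ _ "\<lambda>i\<in>{..<1}. x"]) (use that in auto)
    then show "(\<lambda>x. x 0) ` carrier (power_group G 1) = carrier G" by auto
    show "group_Ufin_O_Gamma (power_group G 1) (power_topology T 1)" using that by blast
  qed
qed (intro allI group_Ufin_O_Gamma_power[OF tg])


section \<open>The universal uniformity\<close>

lemma is_uniformity_superset:
  assumes "is_uniformity Z \<U>" "E \<in> \<U>" "E \<subseteq> D" "D \<subseteq> Z \<times> Z"
  shows "D \<in> \<U>"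
  using assms(1)[unfolded is_uniformity_def, THEN conjunct2, THEN conjunct2, THEN conjunct1,
      THEN bspec, OF assms(2), THEN spec, THEN mp] assms(3,4) by blast

lemma compatible_uniformity_nhd:
  assumes "compatible_uniformity X \<U>" "E \<in> \<U>" "z \<in> topspace X"
  shows "\<exists>W. openin X W \<and> z \<in> W \<and> W \<subseteq> E `` {z}"
  using uniform_interior(1-3)[of "topspace X" \<U> E z] assms
  unfolding compatible_uniformity_def by auto

text \<open>Adding the pulled-back entourages to the universal uniformity does not change the topology, by
  continuity of \<open>f\<close>. The enlarged uniformity is thus compatible, and by maximality it is
  the universal one.\<close>

lemma continuous_map_uniformly_continuous_universal:
  assumes X: "completely_regular_space X" and V: "compatible_uniformity T \<V>"
    and f: "continuous_map X T f" and E: "E \<in> \<V>"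
  shows "{(x, y) \<in> topspace X \<times> topspace X. (f x, f y) \<in> E} \<in> universal_uniformity X"
proof -
  let ?Z = "topspace X"
  define \<U> where "\<U> = universal_uniformity X"
  note U = universal_uniformity(1)[OF X, folded \<U>_def]
  have u: "is_uniformity ?Z \<U>" and v: "is_uniformity (topspace T) \<V>"
    using U V by (simp_all add: compatible_uniformity_def)
  have fT: "f x \<in> topspace T" if "x \<in> ?Z" for x
    using continuous_map_image_subset_topspace[OF f] that by blast
  define b where "b D C = D \<inter> {(x, y). (f x, f y) \<in> C}" for D C
  define B where "B = {b D C | D C. D \<in> \<U> \<and> C \<in> \<V>}"
  define \<W> where "\<W> = {E. E \<subseteq> ?Z \<times> ?Z \<and> (\<exists>e\<in>B. e \<subseteq> E)}"
  have BI: "b D C \<in> B" if "D \<in> \<U>" "C \<in> \<V>" for D C using that unfolding B_def by blast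
  have bZ: "b D C \<subseteq> ?Z \<times> ?Z" if "D \<in> \<U>" for D C
    using is_uniformity_subset[OF u that] by (auto simp: b_def)
  have BW: "b D C \<in> \<W>" if "D \<in> \<U>" "C \<in> \<V>" for D C
    using BI[OF that] bZ[OF that(1)] unfolding \<W>_def by blast
  have unif: "is_uniformity ?Z \<W>"
    unfolding \<W>_def
  proof (rule is_uniformity_base)
    show "B \<noteq> {}" using BI[OF is_uniformity_carrier[OF u] is_uniformity_carrier[OF v]] by blast
  next
    fix e assume "e \<in> B"
    then obtain D C where e: "e = b D C" "D \<in> \<U>" "C \<in> \<V>" unfolding B_def by blast
    have "(x, x) \<in> e" if "x \<in> ?Z" for x
      using is_uniformity_refl[OF u e(2)] is_uniformity_refl[OF v e(3)] fT[OF that] that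
      by (auto simp: e(1) b_def)
    then show "e \<subseteq> ?Z \<times> ?Z \<and> Id_on ?Z \<subseteq> e" using bZ[OF e(2), of C] e(1) by auto
    show "\<exists>d\<in>B. d \<subseteq> e\<inverse>"
      by (rule bexI[OF _ BI[OF is_uniformity_converse[OF u e(2)] is_uniformity_converse[OF v e(3)]]])
        (auto simp: e(1) b_def)
    obtain D' C' where "D' \<in> \<U>" "D' O D' \<subseteq> D" "C' \<in> \<V>" "C' O C' \<subseteq> C"
      using is_uniformity_half[OF u e(2)] is_uniformity_half[OF v e(3)] by blast
    then show "\<exists>d\<in>B. d O d \<subseteq> e"
      by (intro bexI[OF _ BI[of D' C']]) (auto simp: e(1) b_def)
    fix d assume "d \<in> B"
    then obtain D' C' where d: "d = b D' C'" "D' \<in> \<U>" "C' \<in> \<V>" unfolding B_def by blast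
    show "\<exists>c\<in>B. c \<subseteq> e \<inter> d"
      by (rule bexI[OF _ BI[OF is_uniformity_Int[OF u e(2) d(2)] is_uniformity_Int[OF v e(3) d(3)]]])
        (auto simp: e(1) d(1) b_def)
  qed
  have "uniform_topology ?Z \<W> = X"
  proof (rule uniform_topology_eqI[OF unif], intro iffI conjI ballI)
    fix N assume N: "openin X N"
    then show "N \<subseteq> ?Z" by (rule openin_subset)
    fix z assume z: "z \<in> N"
    have "openin (uniform_topology ?Z \<U>) N" using N U by (simp add: compatible_uniformity_def)
    then obtain D where D: "D \<in> \<U>" "D `` {z} \<subseteq> N"
      unfolding openin_uniform_topology[OF u] using z by blast
    have "b D (topspace T \<times> topspace T) `` {z} \<subseteq> N" using D(2) by (auto simp: b_def)
    then show "\<exists>E\<in>\<W>. E `` {z} \<subseteq> N" using BW[OF D(1) is_uniformity_carrier[OF v]] by blast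
  next
    fix N assume N: "N \<subseteq> ?Z \<and> (\<forall>z\<in>N. \<exists>E\<in>\<W>. E `` {z} \<subseteq> N)"
    show "openin X N"
    proof (subst openin_subopen, intro ballI)
      fix z assume z: "z \<in> N"
      then have zZ: "z \<in> ?Z" using N by blast
      obtain e where "e \<in> B" "e `` {z} \<subseteq> N" using N z unfolding \<W>_def by blast
      then obtain D C where DC: "b D C `` {z} \<subseteq> N" "D \<in> \<U>" "C \<in> \<V>" unfolding B_def by blast
      obtain W where W: "openin X W" "z \<in> W" "W \<subseteq> D `` {z}"
        using compatible_uniformity_nhd[OF U DC(2) zZ] by blast
      obtain W' where W': "openin T W'" "f z \<in> W'" "W' \<subseteq> C `` {f z}"
        using compatible_uniformity_nhd[OF V DC(3) fT[OF zZ]] by blast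
      have "openin X (W \<inter> {x \<in> ?Z. f x \<in> W'})"
        using W(1) openin_continuous_map_preimage[OF f W'(1)] by blast
      moreover have "W \<inter> {x \<in> ?Z. f x \<in> W'} \<subseteq> N" using W(3) W'(3) DC(1) by (auto simp: b_def)
      ultimately show "\<exists>Q. openin X Q \<and> z \<in> Q \<and> Q \<subseteq> N" using W(2) W'(2) zZ by blast
    qed
  qed
  then have "\<W> \<subseteq> \<U>"
    unfolding \<U>_def using unif by (intro universal_uniformity(2)[OF X]) (simp add: compatible_uniformity_def)
  then have "b (?Z \<times> ?Z) E \<in> \<U>" using BW[OF is_uniformity_carrier[OF u] E] by blast
  moreover have "b (?Z \<times> ?Z) E = {(x, y) \<in> ?Z \<times> ?Z. (f x, f y) \<in> E}" by (auto simp: b_def)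
  ultimately show ?thesis by (simp add: \<U>_def)
qed


section \<open>Chain distances\<close>

text \<open>Chains of points, where a link in the entourage \<open>D m\<close> costs
  \<open>2\<^sup>-\<^sup>m\<close>. The number of links is kept for inductions; the last argument is the
  total cost. Infima of such costs are the usual construction of a pseudometric from a sequence of
  entourages.\<close>

inductive chain :: "(nat \<Rightarrow> ('a \<times> 'a) set) \<Rightarrow> nat \<Rightarrow> 'a \<Rightarrow> 'a \<Rightarrow> real \<Rightarrow> bool" for D where
  Nil: "chain D 0 x x 0"
| Cons: "(x, y) \<in> D m \<Longrightarrow> chain D k y z c \<Longrightarrow> chain D (Suc k) x z ((1/2)^m + c)"

lemma chain_nonneg: "chain D k x z c \<Longrightarrow> 0 \<le> c"
  by (induction rule: chain.induct) auto

text \<open>The link at which the accumulated cost first exceeds \<open>t\<close> separates a part of cost at most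
  \<open>t\<close> from a part of cost at most \<open>c - t\<close>.\<close>

lemma chain_split:
  assumes "chain D k x z c" "0 \<le> t" "t < c"
  shows "\<exists>i j a b m c1 c2. chain D i x a c1 \<and> (a, b) \<in> D m \<and> chain D j b z c2 \<and>
    i < k \<and> j < k \<and> c1 \<le> t \<and> c2 \<le> c - t \<and> (1/2)^m \<le> c"
  using assms
proof (induction arbitrary: t rule: chain.induct)
  case (Cons x y m k z c)
  have c: "0 \<le> c" by (rule chain_nonneg[OF Cons.hyps(2)])
  show ?case
  proof (cases "t < (1/2)^m")
    case True
    have "chain D 0 x x 0 \<and> (x, y) \<in> D m \<and> chain D k y z c \<and> 0 < Suc k \<and> k < Suc k \<and>
        0 \<le> t \<and> c \<le> (1/2)^m + c - t \<and> (1/2)^m \<le> (1/2)^m + c"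
      using True c Cons by (auto intro: chain.Nil)
    then show ?thesis by blast
  next
    case False
    then obtain i j a b n c1 c2 where *: "chain D i y a c1" "(a, b) \<in> D n" "chain D j b z c2"
      "i < k" "j < k" "c1 \<le> t - (1/2)^m" "c2 \<le> c - (t - (1/2)^m)" "(1/2)^n \<le> c"
      using Cons.IH[of "t - (1/2)^m"] Cons.prems by auto
    have "chain D (Suc i) x a ((1/2)^m + c1)" by (rule chain.Cons[OF Cons.hyps(1) *(1)])
    moreover have "(1/2)^n \<le> (1/2)^m + c" using *(8) by (simp add: add_increasing)
    moreover have "Suc i < Suc k" "j < Suc k" "(1/2)^m + c1 \<le> t" "c2 \<le> (1/2)^m + c - t"
      using * by auto
    ultimately show ?thesis using *(2,3) by blast
  qed
qed simp

text \<open>Split the chain at half of its cost. Both parts cost less than half of \<open>2\<^sup>-\<^sup>n\<close>, so by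
  induction their endpoints are related by \<open>D (Suc n)\<close>; the middle link costs less than
  \<open>2\<^sup>-\<^sup>n\<close>, hence at most half of it, and also lies in \<open>D (Suc n)\<close>. Three steps in
  \<open>D (Suc n)\<close> stay in \<open>D n\<close>.\<close>

lemma chain_short:
  assumes sub: "\<And>n. D n \<subseteq> Z \<times> Z" and refl: "\<And>n x. x \<in> Z \<Longrightarrow> (x, x) \<in> D n"
    and cube: "\<And>n. D (Suc n) O D (Suc n) O D (Suc n) \<subseteq> D n"
  shows "chain D k x z c \<Longrightarrow> x \<in> Z \<Longrightarrow> c < (1/2)^n \<Longrightarrow> (x, z) \<in> D n"
proof (induction k arbitrary: x z c n rule: less_induct)
  case (less k)
  have "D (Suc n) \<subseteq> D n" for n
  proof clarify
    fix x y assume *: "(x, y) \<in> D (Suc n)"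
    then have "x \<in> Z" "y \<in> Z" using sub by blast+
    then show "(x, y) \<in> D n" using * refl cube[of n] by blast
  qed
  then have anti: "D m \<subseteq> D n" if "n \<le> m" for n m using lift_Suc_antimono_le[of D] that by blast
  show ?case
  proof (cases "0 < c")
    case False
    from less.prems(1) show ?thesis
    proof cases
      case Nil
      then show ?thesis using refl less.prems by simp
    next
      case (Cons y m k' c')
      then have "c > 0" using chain_nonneg[OF Cons(4)] by (simp add: add_pos_nonneg)
      then show ?thesis using False by simp
    qed
  next
    case True
    obtain i j a b m c1 c2 where *: "chain D i x a c1" "(a, b) \<in> D m" "chain D j b z c2"
      "i < k" "j < k" "c1 \<le> c/2" "c2 \<le> c - c/2" "(1/2)^m \<le> c"
      using chain_split[OF less.prems(1), of "c/2"] True by auto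
    have "c/2 < (1/2)^Suc n" using less.prems(3) by simp
    then have 1: "(x, a) \<in> D (Suc n)" and 3: "(b, z) \<in> D (Suc n)"
      using * less.IH[OF *(4,1) less.prems(2), of "Suc n"] less.IH[OF *(5,3), of "Suc n"] sub
      by auto
    have "(1/2::real)^m < (1/2)^n" using *(8) less.prems(3) by (rule le_less_trans)
    then have "Suc n \<le> m" by (simp add: power_strict_decreasing_iff)
    then have "(a, b) \<in> D (Suc n)" using anti *(2) by blast
    then show ?thesis using 1 3 cube by blast
  qed
qed

text \<open>The distance \<open>d x z\<close> is the infimum of the costs of chains from \<open>x\<close> to
  \<open>z\<close>, bounded by \<open>1\<close> because \<open>D 0\<close> is the whole square. The fourth
  conclusion replaces the triangle inequality: it is what the continuity of
  \<open>x \<mapsto> d(x, -)\<close> rests on, and it holds because one more link in front of a chain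
  from \<open>y\<close> gives a chain from \<open>x\<close>.\<close>

lemma entourage_distance:
  assumes u: "is_uniformity Z \<U>" and E: "E \<in> \<U>"
  obtains D :: "nat \<Rightarrow> ('a \<times> 'a) set" and d :: "'a \<Rightarrow> 'a \<Rightarrow> real" where
    "\<And>n. D n \<in> \<U>"
    "\<And>x z. x \<in> Z \<Longrightarrow> z \<in> Z \<Longrightarrow> 0 \<le> d x z \<and> d x z \<le> 1"
    "\<And>z. z \<in> Z \<Longrightarrow> d z z = 0"
    "\<And>n x y z. (x, y) \<in> D n \<Longrightarrow> z \<in> Z \<Longrightarrow> \<bar>d x z - d y z\<bar> \<le> (1/2)^n"
    "\<And>x z. x \<in> Z \<Longrightarrow> z \<in> Z \<Longrightarrow> d x z < 1/2 \<Longrightarrow> (x, z) \<in> E"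
proof -
  have "\<exists>D\<in>\<U>. sym D \<and> D O D O D \<subseteq> C" if C: "C \<in> \<U>" for C
  proof -
    obtain C1 where C1: "C1 \<in> \<U>" "C1 O C1 \<subseteq> C" using is_uniformity_half[OF u C] by blast
    obtain C2 where C2: "C2 \<in> \<U>" "C2 O C2 \<subseteq> C1" using is_uniformity_half[OF u C1(1)] by blast
    define D where "D = (C1 \<inter> C2) \<inter> (C1 \<inter> C2)\<inverse>"
    have "D \<in> \<U>"
      unfolding D_def using C1 C2 by (intro is_uniformity_Int[OF u] is_uniformity_converse[OF u])
    moreover have "sym D" unfolding D_def sym_def by blast
    moreover have "D O D O D \<subseteq> C1 O C1" using C2(2) unfolding D_def by blast
    ultimately show ?thesis using C1(2) by blast
  qed
  then obtain h where h: "\<And>C. C \<in> \<U> \<Longrightarrow> h C \<in> \<U> \<and> sym (h C) \<and> h C O h C O h C \<subseteq> C" by metis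
  \<comment> \<open>Intersecting with \<open>E\<close> in each step places \<open>D 1\<close> inside \<open>E\<close>; starting from the
    whole square keeps all chain distances at most \<open>1\<close>.\<close>
  define D where "D = rec_nat (Z \<times> Z) (\<lambda>_ C. h (C \<inter> E))"
  have D0: "D 0 = Z \<times> Z" and DS: "D (Suc n) = h (D n \<inter> E)" for n by (simp_all add: D_def)
  have DU: "D n \<in> \<U>" for n
    by (induction n) (use h is_uniformity_Int[OF u] E is_uniformity_carrier[OF u] in \<open>auto simp: D0 DS\<close>)
  have cubeE: "D (Suc n) O D (Suc n) O D (Suc n) \<subseteq> D n \<inter> E" for n
    unfolding DS using h is_uniformity_Int[OF u DU E] by blast
  have sub: "D n \<subseteq> Z \<times> Z" for n using is_uniformity_subset[OF u DU] .
  have refl: "(x, x) \<in> D n" if "x \<in> Z" for x n using is_uniformity_refl[OF u DU] that by blast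
  have sym: "(y, x) \<in> D n" if "(x, y) \<in> D n" for x y n
  proof (cases n)
    case 0
    then show ?thesis using that by (simp add: D0)
  next
    case (Suc k)
    then have "sym (D n)" unfolding Suc DS using h is_uniformity_Int[OF u DU E] by blast
    then show ?thesis using that by (rule symD)
  qed
  have D1: "(x, y) \<in> E" if "(x, y) \<in> D (Suc 0)" for x y
  proof -
    have "y \<in> Z" using sub that by blast
    then have "(x, y) \<in> D (Suc 0) O D (Suc 0) O D (Suc 0)" using that refl by blast
    then show ?thesis using cubeE by blast
  qed
  define K where "K x z = {c. \<exists>k. chain D k x z c}" for x z
  define d where "d x z = Inf (K x z)" for x z
  have KI: "c \<in> K x z" if "chain D k x z c" for k x z c
    using that by (auto simp: K_def)
  have K0: "c \<ge> 0" if "c \<in> K x z" for x z c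
    using that unfolding K_def by (auto dest: chain_nonneg)
  then have bdd: "bdd_below (K x z)" for x z by (intro bdd_belowI)
  have K1: "1 \<in> K x z" if "x \<in> Z" "z \<in> Z" for x z
    using KI[OF chain.Cons[of x z D 0, OF _ chain.Nil]] that by (simp add: D0)
  have range: "0 \<le> d x z \<and> d x z \<le> 1" if "x \<in> Z" "z \<in> Z" for x z
  proof
    show "0 \<le> d x z" unfolding d_def using K1[OF that] K0 by (intro cInf_greatest) auto
    show "d x z \<le> 1" unfolding d_def by (rule cInf_lower[OF K1[OF that] bdd])
  qed
  have zero: "d z z = 0" if "z \<in> Z" for z
  proof -
    have "0 \<in> K z z" by (rule KI[OF chain.Nil])
    then have "d z z \<le> 0" unfolding d_def by (rule cInf_lower[OF _ bdd])
    then show ?thesis using range[OF that that] by simp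
  qed
  have step: "d x z \<le> (1/2)^n + d y z" if "(x, y) \<in> D n" "z \<in> Z" for x y z n
  proof -
    have y: "y \<in> Z" using sub that by blast
    have "d x z - (1/2)^n \<le> d y z"
      unfolding d_def[of y]
    proof (rule cInf_greatest)
      show "K y z \<noteq> {}" using K1[OF y that(2)] by blast
      fix c assume "c \<in> K y z"
      then obtain k where "chain D k y z c" unfolding K_def by auto
      then have "(1/2)^n + c \<in> K x z" by (rule KI[OF chain.Cons[where D = D, OF that(1)]])
      then have "d x z \<le> (1/2)^n + c" unfolding d_def by (rule cInf_lower[OF _ bdd])
      then show "d x z - (1/2)^n \<le> c" by simp
    qed
    then show ?thesis by simp
  qed
  have lip: "\<bar>d x z - d y z\<bar> \<le> (1/2)^n" if "(x, y) \<in> D n" "z \<in> Z" for x y z n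
    using step[OF that] step[OF sym[OF that(1)] that(2)] by (simp add: abs_le_iff)
  have small: "(x, z) \<in> E" if xz: "x \<in> Z" "z \<in> Z" "d x z < 1/2" for x z
  proof -
    obtain c where "c \<in> K x z" "c < 1/2"
      using cInf_lessD[of "K x z" "1/2"] xz(3) K1[OF xz(1,2)] unfolding d_def by auto
    then obtain k where "chain D k x z c" "c < (1/2)^Suc 0" unfolding K_def by auto
    then have "(x, z) \<in> D (Suc 0)"
      using chain_short[of D Z k x z c "Suc 0", OF sub refl] cubeE xz(1) by blast
    then show ?thesis by (rule D1)
  qed
  show ?thesis by (rule that[OF DU range zero lip small])
qed


section \<open>Embedding into bounded functions\<close>

definition additive_group :: "'a::ab_group_add monoid" where
  "additive_group = \<lparr>carrier = UNIV, monoid.mult = (+), one = 0\<rparr>"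

lemma additive_group_simps [simp]:
  "carrier additive_group = UNIV" "x \<otimes>\<^bsub>additive_group\<^esub> y = x + y" "\<one>\<^bsub>additive_group\<^esub> = 0"
  by (simp_all add: additive_group_def)

lemma comm_group_additive_group: "comm_group (additive_group :: 'a::ab_group_add monoid)"
proof (rule comm_groupI)
  fix x :: 'a assume "x \<in> carrier additive_group"
  show "\<exists>y\<in>carrier additive_group. y \<otimes>\<^bsub>additive_group\<^esub> x = \<one>\<^bsub>additive_group\<^esub>"
    by (rule bexI[of _ "- x"]) auto
qed (auto simp: add_ac)

lemma inv_additive_group [simp]: "inv\<^bsub>additive_group\<^esub> x = - (x :: 'a::ab_group_add)"
proof -
  interpret comm_group "additive_group :: 'a monoid" by (rule comm_group_additive_group)
  show ?thesis by (rule inv_equality) auto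
qed

lemma topological_group_additive_group:
  "topological_group (additive_group :: 'a::real_normed_vector monoid) euclidean"
proof (rule topological_groupI)
  show "group (additive_group :: 'a monoid)"
    using comm_group_additive_group by (rule comm_group.axioms)
  have "continuous_map euclidean euclidean (\<lambda>p::'a \<times> 'a. fst p - snd p)"
    by (simp add: continuous_on_diff continuous_on_fst continuous_on_snd)
  then show "continuous_map (prod_topology euclidean euclidean) euclidean
      (\<lambda>(x::'a, y). x \<otimes>\<^bsub>additive_group\<^esub> inv\<^bsub>additive_group\<^esub> y)"
    by (simp add: euclidean_product_topology case_prod_unfold)
qed simp

text \<open>This is the Kuratowski map \<open>x \<mapsto> d(x, -)\<close>. Evaluating \<open>f x - f y\<close> at
  \<open>y\<close> gives \<open>d x y\<close>, so the norm of the difference dominates the distance. The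
  discrete topology on the domain turns all bounded functions into bounded continuous ones, which
  form a normed space; outside the points of \<open>X\<close> the functions are set to zero.\<close>

lemma entourage_from_bounded_functions:
  fixes X :: "'a topology"
  assumes X: "compatible_uniformity X \<U>" and E: "E \<in> \<U>"
  shows "\<exists>f :: 'a \<Rightarrow> 'a discrete \<Rightarrow>\<^sub>C real. continuous_map X euclidean f \<and>
    (\<forall>x\<in>topspace X. \<forall>y\<in>topspace X. norm (f x - f y) < 1/2 \<longrightarrow> (x, y) \<in> E)"
proof -
  let ?Z = "topspace X"
  have u: "is_uniformity ?Z \<U>" using X by (simp add: compatible_uniformity_def)
  obtain D d where D: "\<And>n. D n \<in> \<U>"
    and range: "\<And>x z. x \<in> ?Z \<Longrightarrow> z \<in> ?Z \<Longrightarrow> 0 \<le> d x z \<and> d x z \<le> 1"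
    and zero: "\<And>z. z \<in> ?Z \<Longrightarrow> d z z = 0"
    and lip: "\<And>n x y z. (x, y) \<in> D n \<Longrightarrow> z \<in> ?Z \<Longrightarrow> \<bar>d x z - d y z\<bar> \<le> (1/2::real)^n"
    and small: "\<And>x z. x \<in> ?Z \<Longrightarrow> z \<in> ?Z \<Longrightarrow> d x z < 1/2 \<Longrightarrow> (x, z) \<in> E"
    by (rule entourage_distance[OF u E]) (rule that, assumption+)
  define g where "g x z = (if x \<in> ?Z \<and> of_discrete z \<in> ?Z then d x (of_discrete z) else 0)" for x z
  have g: "g x \<in> bcontfun" for x
    by (rule bcontfun_normI[where b = 1])
      (use range in \<open>auto simp: g_def continuous_on_open_invariant open_discrete\<close>)
  define f where "f x = Bcontfun (g x)" for x
  have f: "apply_bcontfun (f x) = g x" for x unfolding f_def by (rule Bcontfun_inverse[OF g])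
  have near: "dist (f x) (f y) \<le> (1/2)^n" if "(x, y) \<in> D n" for x y n
  proof (rule dist_bound)
    fix z :: "'a discrete"
    have "x \<in> ?Z" "y \<in> ?Z" using is_uniformity_subset[OF u D] that by blast+
    then show "dist (apply_bcontfun (f x) z) (apply_bcontfun (f y) z) \<le> (1/2)^n"
      using lip[OF that] by (simp add: f g_def dist_real_def)
  qed
  have "continuous_map X euclidean f"
    unfolding continuous_map_def
  proof (intro conjI allI impI)
    fix V :: "('a discrete \<Rightarrow>\<^sub>C real) set" assume "openin euclidean V"
    then have V: "open V" by simp
    have "\<exists>C\<in>\<U>. C `` {x} \<subseteq> {x \<in> ?Z. f x \<in> V}" if x: "x \<in> ?Z" "f x \<in> V" for x
    proof -
      obtain r where r: "r > 0" "ball (f x) r \<subseteq> V" using V x(2) open_contains_ball by blast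
      obtain n where n: "(1/2)^n < r" using real_arch_pow_inv[OF r(1), of "1/2"] by auto
      have "D n `` {x} \<subseteq> {x \<in> ?Z. f x \<in> V}"
      proof
        fix y assume "y \<in> D n `` {x}"
        then have y: "(x, y) \<in> D n" by simp
        then have "y \<in> ?Z" using is_uniformity_subset[OF u D] by blast
        moreover have "f y \<in> V" 
          using le_less_trans[OF near[OF y] n] r(2) by (auto simp: subset_iff)
        ultimately show "y \<in> {x \<in> ?Z. f x \<in> V}" by simp
      qed
      then show ?thesis using D by blast
    qed
    then have "openin (uniform_topology ?Z \<U>) {x \<in> ?Z. f x \<in> V}"
      unfolding openin_uniform_topology[OF u] by auto
    then show "openin X {x \<in> ?Z. f x \<in> V}" using X by (simp add: compatible_uniformity_def)
  qed simp
  moreover have "(x, y) \<in> E" if "x \<in> ?Z" "y \<in> ?Z" "norm (f x - f y) < 1/2" for x y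
  proof -
    have "dist (apply_bcontfun (f x) (discrete y)) (apply_bcontfun (f y) (discrete y)) < 1/2"
      using dist_bounded[of "f x" "discrete y" "f y"] that(3) by (simp add: dist_norm)
    then have "d x y < 1/2"
      using that(1,2) zero by (simp add: f g_def discrete_inverse dist_real_def)
    then show ?thesis by (rule small[OF that(1,2)])
  qed
  ultimately show ?thesis by blast
qed


section \<open>Free topological groups\<close>

lemma embedding_map_imp_continuous_map: "embedding_map X T f \<Longrightarrow> continuous_map X T f"
  unfolding embedding_map_def
  by (drule homeomorphic_imp_continuous_map) (simp add: continuous_map_in_subtopology)

lemma
  assumes "free_topological_group X G T \<eta>"
  shows free_topological_groupD: "topological_group G T" "continuous_map X T \<eta>"
    "generate G (\<eta> ` topspace X) = carrier G"
proof -
  note f = assms[unfolded free_topological_group_def]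
  show "topological_group G T" by (rule f[THEN conjunct1])
  show "continuous_map X T \<eta>"
    by (rule embedding_map_imp_continuous_map[OF f[THEN conjunct2, THEN conjunct1]])
  show "generate G (\<eta> ` topspace X) = carrier G"
    by (rule f[THEN conjunct2, THEN conjunct2, THEN conjunct1])
qed

lemma
  assumes "free_abelian_topological_group X G T \<eta>"
  shows free_abelian_topological_groupD: "topological_group G T" "continuous_map X T \<eta>"
    "generate G (\<eta> ` topspace X) = carrier G"
proof -
  note f = assms[unfolded free_abelian_topological_group_def]
  show "topological_group G T" by (rule f[THEN conjunct1])
  show "continuous_map X T \<eta>"
    by (rule embedding_map_imp_continuous_map[OF f[THEN conjunct2, THEN conjunct2, THEN conjunct1]])
  show "generate G (\<eta> ` topspace X) = carrier G"
    by (rule f[THEN conjunct2, THEN conjunct2, THEN conjunct2, THEN conjunct1])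
qed

lemma hom_generate_surj:
  assumes h: "h \<in> hom G H" and "group G" "group H" and gen: "generate H S = carrier H"
    and S: "S \<subseteq> h ` carrier G"
  shows "h ` carrier G = carrier H"
proof -
  interpret group_hom G H h
    using assms by (simp add: group_hom_def group_hom_axioms_def)
  have "generate H S \<subseteq> h ` carrier G"
    by (rule H.generate_subgroup_incl[OF S img_is_subgroup])
  then show ?thesis using gen by auto
qed

lemma Ufin_free_imp_free_abelian:
  assumes F: "free_topological_group X F TF \<eta>F" and A: "free_abelian_topological_group X A TA \<eta>A"
    and "group_Ufin_O_Gamma F TF"
  shows "group_Ufin_O_Gamma A TA"
proof -
  note tF = free_topological_groupD(1)[OF F] and cF = free_topological_groupD(2)[OF F]
  note tA = free_abelian_topological_groupD(1)[OF A] and cA = free_abelian_topological_groupD(2)[OF A]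
    and gA = free_abelian_topological_groupD(3)[OF A]
  obtain h where h: "h \<in> hom F A" "continuous_map TF TA h" "\<forall>x\<in>topspace X. h (\<eta>F x) = \<eta>A x"
    using free_topological_group_extend[OF F tA cA] by blast
  have "\<eta>F x \<in> carrier F" if "x \<in> topspace X" for x
    using continuous_map_image_subset_topspace[OF cF] tF that by (auto simp: topological_group_def)
  then have "\<eta>A ` topspace X \<subseteq> h ` carrier F" using h(3) by force
  then have "h ` carrier F = carrier A"
    using hom_generate_surj[OF h(1) _ _ gA] tF tA by (simp add: topological_group_def)
  then show ?thesis by (rule group_Ufin_O_Gamma_image[OF tF tA h(1,2) _ assms(3)])
qed

text \<open>Both \<open>f\<close> and \<open>x \<mapsto> (f x)\<^sup>-\<^sup>1\<close> are continuous, hence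
  uniformly continuous for the universal uniformity. The image of \<open>X\<close> and the set of its
  inverses are therefore bounded, and so is the group that they generate.\<close>

lemma Ufin_universal_imp_generated_group:
  assumes X: "completely_regular_space X" and tg: "topological_group G T"
    and f: "continuous_map X T f" and gen: "generate G (f ` topspace X) = carrier G"
    and Ufin: "Ufin_O_Gamma (topspace X) (universal_uniformity X)"
  shows "group_Ufin_O_Gamma G T"
proof -
  have top: "topspace T = carrier G" using tg by (simp add: topological_group_def)
  have "is_uniformity (topspace X) (universal_uniformity X)"
    using universal_uniformity(1)[OF X] by (simp add: compatible_uniformity_def)
  then have bX: "Hurewicz_bounded (topspace X) (universal_uniformity X) (topspace X)"
    using Ufin by (simp add: Ufin_O_Gamma_iff_Hurewicz_bounded)
  have b: "Hurewicz_bounded (carrier G) (right_uniformity G T) (g ` topspace X)"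
    if g: "continuous_map X T g" for g
  proof (rule Hurewicz_bounded_image[OF bX order_refl])
    show "g ` topspace X \<subseteq> carrier G" using continuous_map_image_subset_topspace[OF g] top by simp
  qed (rule continuous_map_uniformly_continuous_universal[OF X compatible_right_uniformity[OF tg] g])
  have "continuous_map X T (\<lambda>x. inv\<^bsub>G\<^esub> f x)"
    using continuous_map_compose[OF f, of T "m_inv G"] tg
    by (simp add: topological_group_def o_def)
  then have "Hurewicz_bounded (carrier G) (right_uniformity G T) (m_inv G ` f ` topspace X)"
    using b by (simp add: image_image)
  then have "Hurewicz_bounded (carrier G) (right_uniformity G T) (generate G (f ` topspace X))"
    using b[OF f] continuous_map_image_subset_topspace[OF f] top
    by (intro Hurewicz_bounded_generate[OF tg]) auto
  then show ?thesis unfolding gen group_Ufin_O_Gamma_iff[OF tg] .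
qed

text \<open>The universal property, applied to maps from \<open>X\<close> to spaces of bounded functions, shows that
  each entourage of the universal uniformity contains the trace on \<open>X\<close> of an entourage of
  \<open>A(X)\<close>. It then remains to pass to a subspace.\<close>

lemma Ufin_free_abelian_imp_universal:
  assumes X: "completely_regular_space X" and A: "free_abelian_topological_group X A TA \<eta>"
    and Ufin: "group_Ufin_O_Gamma A TA"
  shows "Ufin_O_Gamma (topspace X) (universal_uniformity X)"
proof -
  let ?Z = "topspace X"
  note tA = free_abelian_topological_groupD(1)[OF A]
  have eZ: "\<eta> ` ?Z \<subseteq> carrier A"
    using continuous_map_image_subset_topspace[OF free_abelian_topological_groupD(2)[OF A]] tA
    by (simp add: topological_group_def)
  have U: "compatible_uniformity X (universal_uniformity X)" by (rule universal_uniformity(1)[OF X])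
  then have u: "is_uniformity ?Z (universal_uniformity X)" by (simp add: compatible_uniformity_def)
  have "\<exists>D\<in>right_uniformity A TA. \<forall>x\<in>?Z. \<forall>y\<in>?Z. (\<eta> x, \<eta> y) \<in> D \<longrightarrow> (x, y) \<in> E"
    if E: "E \<in> universal_uniformity X" for E
  proof -
    obtain f :: "'a \<Rightarrow> 'a discrete \<Rightarrow>\<^sub>C real" where f: "continuous_map X euclidean f"
      "\<forall>x\<in>?Z. \<forall>y\<in>?Z. norm (f x - f y) < 1/2 \<longrightarrow> (x, y) \<in> E"
      using entourage_from_bounded_functions[OF U E] by blast
    obtain h where h: "h \<in> hom A additive_group" "continuous_map TA euclidean h"
      "\<forall>x\<in>?Z. h (\<eta> x) = f x"
      using free_abelian_topological_group_extend[OF A topological_group_additive_group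
        comm_group_additive_group f(1)] by blast
    have "right_entourage additive_group (ball (0 :: 'a discrete \<Rightarrow>\<^sub>C real) (1/2))
        \<in> right_uniformity additive_group euclidean"
      by (rule right_entourage_in_uniformity) auto
    from continuous_hom_uniformly_continuous[OF tA topological_group_additive_group h(1,2) this]
    show ?thesis
      by (rule bexI[rotated]) (use eZ f(2) h(3) in \<open>auto simp: right_entourage_def\<close>)
  qed
  moreover have "Hurewicz_bounded (carrier A) (right_uniformity A TA) (\<eta> ` ?Z)"
    using Hurewicz_bounded_mono[OF _ eZ] Ufin unfolding group_Ufin_O_Gamma_iff[OF tA] by blast
  ultimately have "Hurewicz_bounded ?Z (universal_uniformity X) ?Z"
    using is_uniformity_right_uniformity[OF tA] by (intro Hurewicz_bounded_vimage)
  then show ?thesis by (simp add: Ufin_O_Gamma_iff_Hurewicz_bounded[OF u])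
qed

theorem theorem3p2:
  fixes X :: "'a topology"
    and F :: "'f monoid" and TF :: "'f topology" and \<eta>F :: "'a \<Rightarrow> 'f"
    and A :: "'b monoid" and TA :: "'b topology" and \<eta>A :: "'a \<Rightarrow> 'b"
  assumes "completely_regular_space X" and "Hausdorff_space X"
    and "free_topological_group X F TF \<eta>F"
    and "free_abelian_topological_group X A TA \<eta>A"
  shows "(group_Ufin_O_Gamma F TF \<longleftrightarrow>
            (\<forall>n. group_Ufin_O_Gamma (power_group F n) (power_topology TF n)))
       \<and> ((\<forall>n. group_Ufin_O_Gamma (power_group F n) (power_topology TF n)) \<longleftrightarrow>
            group_Ufin_O_Gamma A TA)
       \<and> (group_Ufin_O_Gamma A TA \<longleftrightarrow>
            (\<forall>n. group_Ufin_O_Gamma (power_group A n) (power_topology TA n)))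
       \<and> ((\<forall>n. group_Ufin_O_Gamma (power_group A n) (power_topology TA n)) \<longleftrightarrow>
            Ufin_O_Gamma (topspace X) (universal_uniformity X))"
proof -
  note F = free_topological_groupD[OF assms(3)]
  note A = free_abelian_topological_groupD[OF assms(4)]
  show ?thesis
    using group_Ufin_O_Gamma_iff_powers[OF F(1)] group_Ufin_O_Gamma_iff_powers[OF A(1)]
      Ufin_free_imp_free_abelian[OF assms(3,4)] Ufin_free_abelian_imp_universal[OF assms(1,4)]
      Ufin_universal_imp_generated_group[OF assms(1) F]
    by argo
qed

end
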